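(* Let $\Gamma=(X,\mathcal{R})$ be a non-bipartite distance-regular graph with diameter $D\ge3$ having classical parameters $(D,q,\alpha,\beta)$ with $q<-1$, and fix $x\in X$. Assume the intersection number $a_1=0$. Then $\Gamma$ does not support a uniform structure with respect to $x$.
   Context: All graphs are finite, simple, connected and undirected, with distance $\partial$. For a fixed vertex $x$ of eccentricity $\varepsilon$: $V=\mathbb{C}^X$, $A$ the adjacency matrix, $E_i^*$ the diagonal $0/1$ matrix with $(y,y)$-entry $1$ iff $\partial(x,y)=i$; $L=\sum_{i=1}^{\varepsilon}E^*_{i-1}AE^*_i$, $R=\sum_{i=0}^{\varepsilon-1}E^*_{i+1}AE^*_i=L^\top$. $\Gamma_f$ is the graph on $X$ whose edges are the edges $yz$ of $\Gamma$ with $\partial(x,y)\ne\partial(x,z)$ (bipartite, with lowering/raising matrices $L,R$). A parameter matrix is a tridiagonal complex $U=(e_{ij})_{1\le i,j\le\varepsilon}$ with $e_{ii}=1$, with $e_{i,i-1}\neq0$ for all $2\le i\le\varepsilon$ or $e_{i-1,i}\ne0$ for all $2\le i\le\varepsilon$, and every principal submatrix $(e_{ij})_{s\le i,j\le t}$ nonsingular; $e_i^-=e_{i,i-1}$, $e_i^+=e_{i,i+1}$, $e_1^-=e_\varepsilon^+=0$. A bipartite graph admits a uniform structure w.r.t. $x$ if there exist such $U$ and $f\in\mathbb{C}^\varepsilon$ with $e_i^-RL^2+LRL+e_i^+L^2R=f_iL$ on $E_i^*V$ for all $1\le i\le\varepsilon$. A non-bipartite $\Gamma$ supports a uniform structure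 w.r.t. $x$ if $\Gamma_f$ admits one. Distance-regular: $p^h_{ij}=|\{w:\partial(y,w)=i,\partial(z,w)=j\}|$ depends only on $h=\partial(y,z),i,j$; $c_i=p^i_{1,i-1}$, $a_i=p^i_{1,i}$, $b_i=p^i_{1,i+1}$. Classical parameters $(D,q,\alpha,\beta)$: $c_i=[i](1+\alpha[i-1])$, $b_i=([D]-[i])(\beta-\alpha[i])$, $[j]=1+q+\dots+q^{j-1}$. *)

theory Defs
  imports "HOL-Analysis.Analysis" "Jordan_Normal_Form.Determinant"
begin

text \<open>
  A graph on the finite nonempty vertex set \<open>UNIV :: 'v set\<close> is given by its adjacency relation, so
  that the standard module of complex column vectors indexed by the vertices is
  \<open>complex ^ 'v\<close> and matrices indexed by the vertices are elements of \<open>complex ^ 'v ^ 'v\<close>.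
\<close>

definition connected_simple_graph :: "('v \<Rightarrow> 'v \<Rightarrow> bool) \<Rightarrow> bool" where
  "connected_simple_graph adj \<longleftrightarrow> symp adj \<and> irreflp adj \<and> (\<forall>y z. adj\<^sup>*\<^sup>* y z)"

definition bipartite_graph :: "('v \<Rightarrow> 'v \<Rightarrow> bool) \<Rightarrow> bool" where
  "bipartite_graph adj \<longleftrightarrow> (\<exists>S. \<forall>y z. adj y z \<longrightarrow> (y \<in> S \<longleftrightarrow> z \<notin> S))"

text \<open>
  \<open>adj ^^ n\<close> relates the end points of walks of length \<open>n\<close>. The distance is meaningful
  only for connected graphs.
\<close>

definition gdist :: "('v \<Rightarrow> 'v \<Rightarrow> bool) \<Rightarrow> 'v \<Rightarrow> 'v \<Rightarrow> nat" where
  "gdist adj y z = (LEAST n. (adj ^^ n) y z)"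

definition eccentricity :: "('v::finite \<Rightarrow> 'v \<Rightarrow> bool) \<Rightarrow> 'v \<Rightarrow> nat" where
  "eccentricity adj x = Max (range (gdist adj x))"

definition diam :: "('v::finite \<Rightarrow> 'v \<Rightarrow> bool) \<Rightarrow> nat" where
  "diam adj = Max (range (eccentricity adj))"

definition adj_matrix :: "('v::finite \<Rightarrow> 'v \<Rightarrow> bool) \<Rightarrow> complex ^ 'v ^ 'v" where
  "adj_matrix adj = (\<chi> y z. if adj y z then 1 else 0)"

definition dual_idem :: "('v::finite \<Rightarrow> 'v \<Rightarrow> bool) \<Rightarrow> 'v \<Rightarrow> nat \<Rightarrow> complex ^ 'v ^ 'v" where
  "dual_idem adj x i = (\<chi> y z. if y = z \<and> gdist adj x y = i then 1 else 0)"

definition lowering :: "('v::finite \<Rightarrow> 'v \<Rightarrow> bool) \<Rightarrow> 'v \<Rightarrow> complex ^ 'v ^ 'v" where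
  "lowering adj x =
     (\<Sum>i = 1..eccentricity adj x. dual_idem adj x (i - 1) ** adj_matrix adj ** dual_idem adj x i)"

definition raising :: "('v::finite \<Rightarrow> 'v \<Rightarrow> bool) \<Rightarrow> 'v \<Rightarrow> complex ^ 'v ^ 'v" where
  "raising adj x =
     (\<Sum>i = 0..<eccentricity adj x. dual_idem adj x (i + 1) ** adj_matrix adj ** dual_idem adj x i)"

text \<open>
  An \<open>\<epsilon> \<times> \<epsilon>\<close> matrix with rows and columns indexed by \<open>1, \<dots>, \<epsilon>\<close> is a function
  \<open>nat \<Rightarrow> nat \<Rightarrow> complex\<close>; its values outside this range are never used. The principal
  submatrix on the indices \<open>s, \<dots>, t\<close> is shifted to the index set \<open>0, \<dots>, t - s\<close>.
\<close>

definition principal_submatrix :: "(nat \<Rightarrow> nat \<Rightarrow> complex) \<Rightarrow> nat \<Rightarrow> nat \<Rightarrow> complex mat" where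
  "principal_submatrix U s t =
     Matrix.mat (t + 1 - s) (t + 1 - s) (\<lambda>(i, j). U (s + i) (s + j))"

definition parameter_matrix :: "nat \<Rightarrow> (nat \<Rightarrow> nat \<Rightarrow> complex) \<Rightarrow> bool" where
  "parameter_matrix \<epsilon> U \<longleftrightarrow>
     (\<forall>i\<in>{1..\<epsilon>}. \<forall>j\<in>{1..\<epsilon>}. i + 1 < j \<or> j + 1 < i \<longrightarrow> U i j = 0) \<and>
     (\<forall>i\<in>{1..\<epsilon>}. U i i = 1) \<and>
     ((\<forall>i\<in>{2..\<epsilon>}. U i (i - 1) \<noteq> 0) \<or> (\<forall>i\<in>{2..\<epsilon>}. U (i - 1) i \<noteq> 0)) \<and>
     (\<forall>s t. 1 \<le> s \<and> s \<le> t \<and> t \<le> \<epsilon> \<longrightarrow> Determinant.det (principal_submatrix U s t) \<noteq> 0)"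

definition e_minus :: "(nat \<Rightarrow> nat \<Rightarrow> complex) \<Rightarrow> nat \<Rightarrow> complex" where
  "e_minus U i = (if i = 1 then 0 else U i (i - 1))"

definition e_plus :: "nat \<Rightarrow> (nat \<Rightarrow> nat \<Rightarrow> complex) \<Rightarrow> nat \<Rightarrow> complex" where
  "e_plus \<epsilon> U i = (if i = \<epsilon> then 0 else U i (i + 1))"

text \<open>
  The next notion is only of interest for bipartite graphs. The subspace on which the
  identity is required is the image of the \<open>i\<close>-th dual idempotent.
\<close>

definition admits_uniform_structure :: "('v::finite \<Rightarrow> 'v \<Rightarrow> bool) \<Rightarrow> 'v \<Rightarrow> bool" where
  "admits_uniform_structure adj x \<longleftrightarrow>
     (let \<epsilon> = eccentricity adj x; L = lowering adj x; R = raising adj x in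
      \<exists>(U :: nat \<Rightarrow> nat \<Rightarrow> complex) (f :: nat \<Rightarrow> complex).
        parameter_matrix \<epsilon> U \<and>
        (\<forall>i\<in>{1..\<epsilon>}. \<forall>v \<in> range ((*v) (dual_idem adj x i)).
           e_minus U i *s (R *v (L *v (L *v v))) + L *v (R *v (L *v v))
             + e_plus \<epsilon> U i *s (L *v (L *v (R *v v)))
           = f i *s (L *v v)))"

definition flattened :: "('v \<Rightarrow> 'v \<Rightarrow> bool) \<Rightarrow> 'v \<Rightarrow> 'v \<Rightarrow> 'v \<Rightarrow> bool" where
  "flattened adj x y z \<longleftrightarrow> adj y z \<and> gdist adj x y \<noteq> gdist adj x z"

text \<open>
  Distances from \<open>x\<close>, eccentricity, lowering and raising matrix are here those of the flattened graph;
  they agree with those of the original connected graph.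
\<close>

definition supports_uniform_structure :: "('v::finite \<Rightarrow> 'v \<Rightarrow> bool) \<Rightarrow> 'v \<Rightarrow> bool" where
  "supports_uniform_structure adj x \<longleftrightarrow> admits_uniform_structure (flattened adj x) x"

definition dist_count :: "('v::finite \<Rightarrow> 'v \<Rightarrow> bool) \<Rightarrow> nat \<Rightarrow> nat \<Rightarrow> 'v \<Rightarrow> 'v \<Rightarrow> nat" where
  "dist_count adj i j y z = card {w. gdist adj y w = i \<and> gdist adj z w = j}"

definition distance_regular :: "('v::finite \<Rightarrow> 'v \<Rightarrow> bool) \<Rightarrow> bool" where
  "distance_regular adj \<longleftrightarrow>
     connected_simple_graph adj \<and>
     (\<forall>i j y z y' z'. gdist adj y z = gdist adj y' z' \<longrightarrow>
        dist_count adj i j y z = dist_count adj i j y' z')"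

text \<open>
  The number \<open>p\<^sup>h\<^sub>i\<^sub>j\<close> is well defined for a distance-regular graph and \<open>h\<close> at most
  the diameter; it is unspecified otherwise.
\<close>

definition intersection_number ::
    "('v::finite \<Rightarrow> 'v \<Rightarrow> bool) \<Rightarrow> nat \<Rightarrow> nat \<Rightarrow> nat \<Rightarrow> nat" where
  "intersection_number adj h i j =
     (THE n. \<forall>y z. gdist adj y z = h \<longrightarrow> dist_count adj i j y z = n)"

definition c_num :: "('v::finite \<Rightarrow> 'v \<Rightarrow> bool) \<Rightarrow> nat \<Rightarrow> nat" where
  "c_num adj i = intersection_number adj i 1 (i - 1)"

definition a_num :: "('v::finite \<Rightarrow> 'v \<Rightarrow> bool) \<Rightarrow> nat \<Rightarrow> nat" where
  "a_num adj i = intersection_number adj i 1 i"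

definition b_num :: "('v::finite \<Rightarrow> 'v \<Rightarrow> bool) \<Rightarrow> nat \<Rightarrow> nat" where
  "b_num adj i = intersection_number adj i 1 (i + 1)"

definition gauss :: "real \<Rightarrow> nat \<Rightarrow> real" where
  "gauss q j = (\<Sum>k<j. q ^ k)"

definition classical_parameters ::
    "('v::finite \<Rightarrow> 'v \<Rightarrow> bool) \<Rightarrow> nat \<Rightarrow> real \<Rightarrow> real \<Rightarrow> real \<Rightarrow> bool" where
  "classical_parameters adj D q \<alpha> \<beta> \<longleftrightarrow>
     distance_regular adj \<and> diam adj = D \<and>
     (\<forall>i\<in>{1..D}. real (c_num adj i) = gauss q i * (1 + \<alpha> * gauss q (i - 1))) \<and>
     (\<forall>i\<in>{0..<D}. real (b_num adj i) = (gauss q D - gauss q i) * (\<beta> - \<alpha> * gauss q i))"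

end

(*
  Write q for the (negative) base, s = 1/q. Up to an additive constant s^d(y,z) is the Gram matrix M
  of an eigenspace. For d(y,z) = 3 the vector given by the neighbours of y and of z on geodesics, minus
  tau (y - z), has squared norm -(const) times the number of parallelograms of length 3, with const > 0
  because q < -1. So there are no parallelograms and the vector vanishes, which determines the triple
  intersection numbers needed below; summing over neighbours gives the same for length 4.

  The uniform condition on E*_2 V, compared at vertices at distance 2 and 3, gives e_2^+ = 0 and
  e_2^- = 1 - c_2, so c_2 >= 2 by the shape of the parameter matrix. The condition on E*_3 V multiplied
  by L from the left then determines e_3^-, e_3^+ (up to sign) and f_3. Inserted into the (z,y)-entry for
  adjacent z, y it bounds the number of walks counted by L R L from above by less than the trivial lower
  bound b_2. The bound uses alpha >= q - 1, which is the Krein condition q^1_11 >= 0 (the sum of the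
  cubed entries of M is nonnegative).
*)

theory Submission
  imports Defs
begin

text \<open>Entries of the uniform condition count vertices at prescribed distances from three
  vertices \<open>x\<close>, \<open>z\<close>, \<open>y\<close>, and distance-regularity alone does
  not determine such numbers. With \<open>z\<close> adjacent to \<open>x\<close> and no
  parallelograms they are determined, and this shapes the argument. In the condition on the second
  layer \<open>z\<close> is adjacent to \<open>x\<close> already; on the third layer it is at
  distance 2, and the extra factor L moves it to distance 1. The entry used without that factor has
  \<open>z\<close> adjacent to \<open>y\<close>, and its term from L R L is only estimated. The
  assumption a_1 = 0 enters twice: it puts distinct neighbours of a vertex at distance 2, so that
  the inner products in the norm computation are known up to the parallelogram count, and it ties
  \<beta> to \<alpha> and the diameter. The comparison vertices \<open>z\<close> at the same
  distance from \<open>y\<close> as \<open>x\<close> exist because \<alpha> < -1 makes a_2 and a_3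
  positive. If no vertex is at distance 4, then b_3 = 0 and the terms with e_3^+ vanish, so only the
  sign of e_3^+ b_3 is extracted.\<close>

section \<open>Gaussian numbers and the closing numerical inequality\<close>

lemma gauss_closed: "(q - 1) * gauss q j = q ^ j - 1"
  by (induction j) (simp_all add: gauss_def algebra_simps)

lemma gauss_simps [simp]:
  "gauss q 0 = 0" "gauss q (Suc 0) = 1" "gauss q 2 = 1 + q"
  "gauss q 3 = 1 + q + q\<^sup>2" "gauss q 4 = (1 + q) * (1 + q\<^sup>2)"
  by (simp_all add: gauss_def eval_nat_numeral algebra_simps)

lemma sum_constant_fibre:
  fixes c :: real
  shows "finite A \<Longrightarrow> (\<Sum>w\<in>A. of_bool (P w) * c) = real (card {w\<in>A. P w}) * c"
  by (simp add: sum_distrib_right [symmetric] Int_def)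

text \<open>To be applied with r = -q, p = c_2 - 1, \<Delta> = c_3 - c_2 and E = -e_3^-. The upper
  bound on \<open>p\<close> is the Krein bound, the lower bound on \<open>b2\<close> expresses b_3
  >= 0. Since \<open>E\<close> is at least r^2, it suffices to prove the inequality with r^2 in its
  place.\<close>

lemma uniform_inequality:
  fixes r p E b2 \<Delta> :: real
  assumes p: "1 \<le> p" "p \<le> r\<^sup>2 - r - 1" and r: "r > 1"
    and \<Delta>: "\<Delta> = r * (p * (r - 1) + r\<^sup>2)"
    and b2: "b2 \<ge> r\<^sup>2 * (p * (r - 1) + r\<^sup>2 - r + 1)"
    and E: "E * (p * (r\<^sup>2 - r + 1)) = r * (r - 1) * \<Delta>"
  shows "p * b2 + r * \<Delta> < E * (b2 + (p + r) * (r - 1) - (p + 1)\<^sup>2)"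
proof -
  define B where "B = r\<^sup>2 * (p * (r - 1) + r\<^sup>2 - r + 1)"
  have pos: "p * (r\<^sup>2 - r + 1) > 0" using p by (intro mult_pos_pos) auto
  have Er: "E \<ge> r\<^sup>2"
  proof -
    have "p * r \<le> (r\<^sup>2 - r) * r" using p r by (intro mult_right_mono) auto
    then have "p * (r\<^sup>2 - r + 1) \<le> (r - 1) * (p * (r - 1) + r\<^sup>2)"
      by (simp add: algebra_simps power2_eq_square)
    then have "r\<^sup>2 * (p * (r\<^sup>2 - r + 1)) \<le> r\<^sup>2 * ((r - 1) * (p * (r - 1) + r\<^sup>2))"
      by (rule mult_left_mono) simp
    also have "\<dots> = E * (p * (r\<^sup>2 - r + 1))"
      unfolding E \<Delta> by (simp add: algebra_simps power2_eq_square)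
    finally show ?thesis using pos by (rule mult_right_le_imp_le)
  qed
  have p2: "(p + 1)\<^sup>2 \<le> (p + 1) * (r\<^sup>2 - r)"
  proof -
    have "(p + 1) * (p + 1) \<le> (p + 1) * (r\<^sup>2 - r)" using p by (intro mult_left_mono) auto
    then show ?thesis by (simp add: power2_eq_square)
  qed
  have B: "r * B = r ^ 3 * ((p + 1) * (r - 1)) + r ^ 3 * ((r - 1)\<^sup>2 + 1)"
    unfolding B_def by (simp add: algebra_simps eval_nat_numeral)
  have p3: "r\<^sup>2 * (p + 1)\<^sup>2 \<le> r ^ 3 * ((p + 1) * (r - 1))"
    using mult_left_mono [OF p2, of "r\<^sup>2"] by (simp add: algebra_simps eval_nat_numeral)
  have r3: "r ^ 3 * ((r - 1)\<^sup>2 + 1) > r\<^sup>2 * (r - 1)"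
  proof -
    have "r\<^sup>2 * (r - 1) < r\<^sup>2 * (r * ((r - 1)\<^sup>2 + 1))"
    proof (rule mult_strict_left_mono)
      have "r * 1 \<le> r * ((r - 1)\<^sup>2 + 1)" using r by (intro mult_left_mono) auto
      then show "r - 1 < r * ((r - 1)\<^sup>2 + 1)" by simp
    qed (use r in simp)
    then show ?thesis by (simp add: eval_nat_numeral)
  qed
  define A where "A = (p + r) * (r - 1)"
  have A: "A > 0" unfolding A_def using p r by simp
  have rB: "r\<^sup>2 * (p + 1)\<^sup>2 + r\<^sup>2 * (r - 1) < r * B" using B p3 r3 by linarith
  have Bb: "B \<le> b2" using b2 unfolding B_def .
  have B0: "B > 0"
  proof -
    have "r\<^sup>2 * (p + 1)\<^sup>2 + r\<^sup>2 * (r - 1) \<ge> 0" using r by simp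
    then have "r * B > 0" using rB by linarith
    then show ?thesis using r by (simp add: zero_less_mult_iff)
  qed
  have main: "p * b2 + r * \<Delta> < r\<^sup>2 * (b2 + A - (p + 1)\<^sup>2)"
  proof -
    have "r * \<Delta> = B + r\<^sup>2 * (r - 1)" unfolding \<Delta> B_def by (simp add: algebra_simps power2_eq_square)
    \<comment> \<open>The upper bound on \<open>p\<close> enters as r^2 - p >= r + 1. One copy of
      \<open>B\<close> accounts for \<open>r * \<Delta>\<close> up to r^2 (r - 1); by
      \<open>rB\<close> the other r copies exceed this remainder plus the square term.\<close>
    moreover have "(r + 1) * B \<le> (r\<^sup>2 - p) * b2"
      using p B0 Bb r by (intro mult_mono) auto
    moreover have "r\<^sup>2 * A > 0" using A r by simp
    ultimately show ?thesis using rB by (simp add: algebra_simps)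
  qed
  have "0 < r\<^sup>2 * (b2 + A - (p + 1)\<^sup>2)"
  proof -
    have "p * b2 \<ge> 0" using p B0 Bb by simp
    moreover have "r * \<Delta> \<ge> 0" unfolding \<Delta> using p r by simp
    ultimately show ?thesis using main by linarith
  qed
  then have "b2 + A - (p + 1)\<^sup>2 > 0" using r by (simp add: zero_less_mult_iff)
  then have "r\<^sup>2 * (b2 + A - (p + 1)\<^sup>2) \<le> E * (b2 + A - (p + 1)\<^sup>2)"
    using Er by (intro mult_right_mono) auto
  with main show ?thesis unfolding A_def by linarith
qed

section \<open>The setting, in terms of the distance function alone\<close>

text \<open>The condition \<open>a\<^sub>1 = 0\<close> gives \<open>\<beta> = 1 + \<alpha> - \<alpha>[D]\<close>, which turns \<open>([D] - [h])(\<beta> - \<alpha>[h])\<close> into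
  \<open>k - [h](1 + \<alpha> - \<alpha>[h])\<close>: in terms of the valency \<open>k\<close> the diameter disappears.\<close>

locale negative_type_metric =
  fixes d :: "'v::finite \<Rightarrow> 'v \<Rightarrow> nat" and q \<alpha> k :: real
  assumes sym: "d y z = d z y"
    and zero_iff [simp]: "d y z = 0 \<longleftrightarrow> y = z"
    and triangle: "d y z \<le> d y w + d w z"
    and geodesic: "d y z = Suc h \<Longrightarrow> \<exists>w. d y w = 1 \<and> d w z = h"
    and regular: "d y z = d y' z' \<Longrightarrow>
      card {w. d y w = i \<and> d z w = j} = card {w. d y' w = i \<and> d z' w = j}"
    and c_count: "d y z = Suc h \<Longrightarrow> real (card {w. d y w = 1 \<and> d z w = h})
      = gauss q (Suc h) * (1 + \<alpha> * gauss q h)"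
    and b_count: "d y z = h \<Longrightarrow> real (card {w. d y w = 1 \<and> d z w = Suc h})
      = k - gauss q h * (1 + \<alpha> - \<alpha> * gauss q h)"
    and triangle_free: "d y z = 1 \<Longrightarrow> d y w = 1 \<Longrightarrow> d z w \<noteq> 1"
    and q_less: "q < -1"
begin

definition c :: "nat \<Rightarrow> real" where
  "c h = gauss q h * (1 + \<alpha> * gauss q (h - 1))"

definition b :: "nat \<Rightarrow> real" where
  "b h = k - gauss q h * (1 + \<alpha> - \<alpha> * gauss q h)"

lemma card_c: "d y z = Suc h \<Longrightarrow> real (card {w. d y w = 1 \<and> d z w = h}) = c (Suc h)"
  using c_count [of y z h] by (simp add: c_def)

lemma card_b: "d y z = h \<Longrightarrow> real (card {w. d y w = 1 \<and> d z w = Suc h}) = b h"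
  using b_count [of y z h] by (simp add: b_def)

lemma valency: "real (card {w. d y w = 1}) = k"
proof -
  have "{w. d y w = 1} = {w. d y w = 1 \<and> d y w = Suc 0}" by auto
  then show ?thesis using b_count [of y y 0] by simp
qed

lemma dist_self [simp]: "d y y = 0" by simp

lemma dist_neighbour:
  assumes "d y w = 1"
  shows "d z w = Suc (d y z) \<or> d z w = d y z \<or> Suc (d z w) = d y z"
  using triangle [of y z w] triangle [of z w y] assms sym [of y z] sym [of w z] sym [of y w]
  by linarith

text \<open>The adjacency matrix acting on a function of the distance to \<open>z\<close>, with a_h
  written as k - c_h - b_h.\<close>

lemma neighbour_sum:
  fixes g :: "nat \<Rightarrow> real"
  assumes "d y z = h"
  shows "(\<Sum>w | d y w = 1. g (d z w)) = c h * g (h - 1) + (k - c h - b h) * g h + b h * g (Suc h)"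
proof -
  let ?G = "{w. d y w = 1}"
  have "(\<Sum>w\<in>?G. g (d z w)) = (\<Sum>w\<in>?G. g h + of_bool (Suc (d z w) = h) * (g (h - 1) - g h)
          + of_bool (d z w = Suc h) * (g (Suc h) - g h))"
  proof (rule sum.cong [OF refl])
    fix w assume "w \<in> ?G"
    then have "d z w = Suc h \<or> d z w = h \<or> Suc (d z w) = h"
      using dist_neighbour [of y w z] assms by simp
    then show "g (d z w) = g h + of_bool (Suc (d z w) = h) * (g (h - 1) - g h)
        + of_bool (d z w = Suc h) * (g (Suc h) - g h)"
      by (elim disjE) auto
  qed
  also have "\<dots> = k * g h + real (card {w\<in>?G. Suc (d z w) = h}) * (g (h - 1) - g h)
      + real (card {w\<in>?G. d z w = Suc h}) * (g (Suc h) - g h)"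
    by (simp add: sum.distrib sum_constant_fibre valency [of y, simplified] del: sum_of_bool_mult_eq)
  also have "real (card {w\<in>?G. d z w = Suc h}) = b h"
    using card_b [OF assms] by simp
  also have "real (card {w\<in>?G. Suc (d z w) = h}) = c h"
  proof (cases h)
    \<comment> \<open>The truncated \<open>h - 1\<close> is harmless at 0, since \<open>c 0\<close>
      vanishes.\<close>
    case 0 then show ?thesis by (simp add: c_def)
  next
    case (Suc h') then show ?thesis using card_c [of y z h'] assms by simp
  qed
  finally show ?thesis by (simp add: algebra_simps)
qed

lemma k_nonneg: "k \<ge> 0" using valency [of undefined] by (metis of_nat_0_le_iff)

section \<open>The Gram matrix of an eigenspace\<close>

definition s :: real where "s = 1 / q"

lemma s_bounds: "-1 < s" "s < 0"
  using q_less by (auto simp: s_def field_simps)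

lemma q_s: "q * s = 1" "s * q = 1" using q_less by (auto simp: s_def)

lemma q_power_s: "q ^ n * s ^ n = 1" by (simp add: power_mult_distrib [symmetric] q_s)

text \<open>The difference \<open>c h - s b h\<close> is affine in \<open>q ^ h\<close>; this is the reason why \<open>s ^ d y z\<close> is, up
  to an additive constant, the cosine sequence of an eigenspace.\<close>

definition \<theta> :: real where "\<theta> = (k - 1) * s - 1"
definition \<eta> :: real where "\<eta> = 1 + s"
definition \<kappa> :: real where "\<kappa> = \<eta> / (\<theta> - k)"
definition m :: "nat \<Rightarrow> real" where "m h = s ^ h + \<kappa>"

lemma theta_less: "\<theta> - k < 0"
proof -
  have "\<theta> - k = k * (s - 1) - (1 + s)" by (simp add: \<theta>_def algebra_simps)
  moreover have "k * (s - 1) \<le> 0"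
    using k_nonneg s_bounds by (intro mult_nonneg_nonpos) auto
  ultimately show ?thesis using s_bounds by linarith
qed

lemma recurrence_s:
  "c h * s ^ (h - 1) + (k - c h - b h) * s ^ h + b h * s ^ Suc h = \<theta> * s ^ h + \<eta>"
proof (cases h)
  case 0 then show ?thesis by (simp add: c_def b_def \<theta>_def \<eta>_def algebra_simps)
next
  case (Suc j)
  define t where "t = q ^ j"
  define u where "u = s ^ j"
  have tu: "t * u = 1" by (simp add: t_def u_def q_power_s)
  define g where "g = gauss q j"
  have g: "t = 1 + (q - 1) * g" by (simp add: t_def g_def gauss_closed)
  have g': "gauss q (Suc j) = 1 + q * g"
    by (simp add: g_def gauss_def lessThan_Suc_atMost sum.atMost_shift sum_distrib_left del: sum.lessThan_Suc)
  \<comment> \<open>The terms with \<alpha> cancel because s q = 1; hence \<theta> does not involve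
    \<alpha>.\<close>
  have "c h - s * (b h - k) = (1 + q * g) * (1 + \<alpha> * g + s - \<alpha> * g * (s * q))"
    by (simp add: c_def b_def Suc g' g_def [symmetric] algebra_simps)
  also have "\<dots> = (1 + q * g) * (1 + s)" by (simp add: q_s)
  finally have *: "c h - s * (b h - k) = (1 + q * g) * (1 + s)" .
  have "c h * u + (k - c h - b h) * (s * u) + b h * (s * (s * u))
      = (1 - s) * (c h - s * (b h - k)) * u + k * (s * (s * u))"
    by (simp add: algebra_simps)
  also have "\<dots> = (1 + s) * (1 - s + q * g - (s * q) * g) * u + k * (s * (s * u))"
    unfolding * by (simp add: algebra_simps)
  also have "\<dots> = \<theta> * (s * u) + \<eta> * (t * u)"
    unfolding q_s g by (simp add: \<theta>_def \<eta>_def algebra_simps)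
  finally have "c h * u + (k - c h - b h) * (s * u) + b h * (s * (s * u))
      = \<theta> * (s * u) + \<eta> * (t * u)" .
  then show ?thesis using Suc tu by (simp add: u_def)
qed

text \<open>Constants have eigenvalue \<open>k\<close>, so adding \<open>\<kappa>\<close> absorbs
  the inhomogeneous term \<open>\<eta>\<close> exactly when \<kappa> (\<theta> - k) =
  \<eta>.\<close>

lemma recurrence_m: "c h * m (h - 1) + (k - c h - b h) * m h + b h * m (Suc h) = \<theta> * m h"
proof -
  have "\<kappa> * (\<theta> - k) = \<eta>" using theta_less by (simp add: \<kappa>_def)
  then show ?thesis using recurrence_s [of h] by (simp add: m_def algebra_simps)
qed

lemma m_neighbour_sum: "(\<Sum>w | d y w = 1. m (d z w)) = \<theta> * m (d y z)"
  using neighbour_sum [of y z "d y z" m] recurrence_m [of "d y z"] by simp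

lemma adjacency_self_adjoint: "(\<Sum>y\<in>UNIV. g y * (\<Sum>w | d y w = 1. h w)) = (\<Sum>y\<in>UNIV. (\<Sum>w | d y w = 1. g w) * h y)"
  for g h :: "'v \<Rightarrow> real"
proof -
  have "(\<Sum>y\<in>UNIV. g y * (\<Sum>w | d y w = 1. h w)) = (\<Sum>y\<in>UNIV. \<Sum>w | w \<in> UNIV \<and> d y w = 1. g y * h w)"
    by (simp add: sum_distrib_left)
  also have "\<dots> = (\<Sum>w\<in>UNIV. \<Sum>y | y \<in> UNIV \<and> d y w = 1. g y * h w)"
    by (rule sum.swap_restrict) auto
  also have "\<dots> = (\<Sum>w\<in>UNIV. (\<Sum>y | d w y = 1. g y) * h w)"
    by (simp add: sum_distrib_right sym)
  finally show ?thesis .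
qed

lemma b_pos:
  assumes "d y z = Suc h" shows "b h > 0"
proof -
  obtain w where w: "d y w = 1" "d w z = h" using geodesic [OF assms] by blast
  then have "y \<in> {u. d w u = 1 \<and> d z u = Suc h}" using assms sym by auto
  then have "card {u. d w u = 1 \<and> d z u = Suc h} > 0" by (auto simp: card_gt_0_iff)
  then show ?thesis using card_b [OF w(2)] by simp
qed

text \<open>As \<open>b h > 0\<close>, the three-term recurrence can be solved for the value at
  \<open>Suc h\<close>, so the value at 0 determines the function. The proportionality is multiplied
  out because nothing is assumed here about the sign of \<open>m 0\<close>.\<close>

lemma eigenfunction_unique:
  assumes eig: "\<And>y z. (\<Sum>w | d y w = 1. g (d z w)) = \<theta> * g (d y z)"
  shows "g (d y z) * m 0 = g 0 * m (d y z)"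
proof (induction "d y z" arbitrary: y z rule: less_induct)
  case less
  show ?case
  proof (cases "d y z")
    case 0 then show ?thesis by simp
  next
    case (Suc h)
    obtain w where w: "d y w = 1" "d w z = h" using geodesic [OF Suc] by blast
    have gh: "g h * m 0 = g 0 * m h" using less [of w z] w Suc by simp
    \<comment> \<open>For h = 0 there is no vertex at distance h - 1; the factor \<open>c h\<close>,
      then 0, covers this case.\<close>
    have gh': "c h * (g (h - 1) * m 0) = c h * (g 0 * m (h - 1))"
    proof (cases h)
      case 0 then show ?thesis by (simp add: c_def)
    next
      case (Suc h')
      obtain u where "d u z = h'" using geodesic [of w z h'] w Suc by blast
      then show ?thesis using less [of u z] Suc \<open>d y z = Suc h\<close> by simp
    qed
    have "c h * g (h - 1) + (k - c h - b h) * g h + b h * g (Suc h) = \<theta> * g h"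
      using neighbour_sum [OF w(2), of g] eig [where y = w and z = z] w(2) by simp
    moreover have "c h * (g (h - 1) * m 0) + (k - c h - b h - \<theta>) * (g h * m 0) + b h * (g (Suc h) * m 0)
        = (c h * g (h - 1) + (k - c h - b h) * g h + b h * g (Suc h) - \<theta> * g h) * m 0"
      by (simp add: algebra_simps)
    ultimately have "c h * (g (h - 1) * m 0) + (k - c h - b h - \<theta>) * (g h * m 0) + b h * (g (Suc h) * m 0) = 0"
      by simp
    moreover have "c h * (g 0 * m (h - 1)) + (k - c h - b h - \<theta>) * (g 0 * m h) + b h * (g 0 * m (Suc h))
        = g 0 * (c h * m (h - 1) + (k - c h - b h) * m h + b h * m (Suc h) - \<theta> * m h)"
      by (simp add: algebra_simps)
    ultimately have "b h * (g (Suc h) * m 0) = b h * (g 0 * m (Suc h))"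
      unfolding recurrence_m gh gh' diff_self mult_zero_right by linarith
    then show ?thesis using b_pos [OF Suc] Suc by simp
  qed
qed

lemma m_0_pos:
  assumes "d y z = 1" shows "m 0 > 0"
proof -
  have "k * m 1 = \<theta> * m 0" using recurrence_m [of 0] by (simp add: c_def b_def)
  then have "k * (m 0 - m 1) = (k - \<theta>) * m 0" by (simp add: algebra_simps)
  moreover have "k > 0" using b_pos [of y z 0] assms by (simp add: b_def)
  moreover have "m 0 - m 1 > 0" using s_bounds by (simp add: m_def)
  ultimately show ?thesis using theta_less
    by (smt (verit) mult_pos_pos zero_less_mult_iff)
qed

lemma convolution_dist:
  fixes f g :: "nat \<Rightarrow> real"
  assumes "d y z = d y' z'"
  shows "(\<Sum>w\<in>UNIV. f (d y w) * g (d z w)) = (\<Sum>w\<in>UNIV. f (d y' w) * g (d z' w))"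
proof -
  have *: "(\<Sum>w\<in>UNIV. f (d y w) * g (d z w))
      = (\<Sum>p\<in>range (\<lambda>p. d (fst p) (snd p)) \<times> range (\<lambda>p. d (fst p) (snd p)).
          real (card {w. d y w = fst p \<and> d z w = snd p}) * (f (fst p) * g (snd p)))" for y z
  proof -
    have "(\<Sum>w\<in>UNIV. f (d y w) * g (d z w))
      = (\<Sum>p\<in>range (\<lambda>p. d (fst p) (snd p)) \<times> range (\<lambda>p. d (fst p) (snd p)).
          \<Sum>w\<in>{w \<in> UNIV. (d y w, d z w) = p}. f (d y w) * g (d z w))"
      by (rule sum.group [symmetric]) (simp, simp, simp add: image_subset_iff image_iff, blast)
    also have "\<dots> = (\<Sum>p\<in>range (\<lambda>p. d (fst p) (snd p)) \<times> range (\<lambda>p. d (fst p) (snd p)).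
          \<Sum>w\<in>{w. d y w = fst p \<and> d z w = snd p}. f (fst p) * g (snd p))"
      by (intro sum.cong) auto
    finally show ?thesis by simp
  qed
  show ?thesis unfolding * regular [OF assms] ..
qed

text \<open>The square of the matrix M is again a function of the distance with columns in the
  eigenspace of \<theta>, so by uniqueness it is a multiple of M. Its diagonal and that of M are
  positive, hence so is the factor, and M is positive semidefinite.\<close>

lemma m_idempotent:
  assumes "d y\<^sub>0 z\<^sub>0 = 1"
  obtains \<mu> where "\<mu> > 0" "\<And>y z. m (d y z) = \<mu> * (\<Sum>w\<in>UNIV. m (d y w) * m (d z w))"
proof -
  define F where "F y z = (\<Sum>w\<in>UNIV. m (d y w) * m (d z w))" for y z
  \<comment> \<open>Any pair at distance h serves, by \<open>convolution_dist\<close>; at lengths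
    that do not occur the value is arbitrary.\<close>
  define f where "f h = (let p = SOME p. d (fst p) (snd p) = h in F (fst p) (snd p))" for h
  have f: "f (d y z) = F y z" for y z
  proof -
    have "d (fst (SOME p. d (fst p) (snd p) = d y z)) (snd (SOME p. d (fst p) (snd p) = d y z)) = d y z"
      by (rule someI [of _ "(y, z)"]) simp
    then show ?thesis unfolding f_def Let_def F_def by (rule convolution_dist)
  qed
  have "(\<Sum>w | d y w = 1. f (d z w)) = \<theta> * f (d y z)" for y z
  proof -
    have "(\<Sum>w | d y w = 1. f (d z w)) = (\<Sum>w | d y w = 1. \<Sum>u\<in>UNIV. m (d z u) * m (d u w))"
      unfolding f F_def using sym by simp
    also have "\<dots> = (\<Sum>u\<in>UNIV. m (d z u) * (\<Sum>w | d y w = 1. m (d u w)))"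
      by (subst sum.swap) (simp add: sum_distrib_left)
    also have "\<dots> = \<theta> * f (d y z)"
      unfolding m_neighbour_sum f F_def by (simp add: sum_distrib_left algebra_simps)
    finally show ?thesis .
  qed
  then have uniq: "f (d y z) * m 0 = f 0 * m (d y z)" for y z by (rule eigenfunction_unique)
  have m0: "m 0 > 0" using m_0_pos [OF assms] .
  have "f 0 = F y\<^sub>0 y\<^sub>0" using f [of y\<^sub>0 y\<^sub>0] by simp
  also have "\<dots> \<ge> (\<Sum>w\<in>{y\<^sub>0}. m (d y\<^sub>0 w) * m (d y\<^sub>0 w))"
    unfolding F_def by (intro sum_mono2) auto
  finally have f0: "f 0 > 0" using m0 by simp (metis mult_pos_pos order_less_le_trans)
  show ?thesis
  proof
    show "m 0 / f 0 > 0" using m0 f0 by simp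
    show "m (d y z) = m 0 / f 0 * (\<Sum>w\<in>UNIV. m (d y w) * m (d z w))" for y z
      using uniq [of y z] f0 unfolding f F_def by (simp add: field_simps)
  qed
qed

definition form :: "('v \<Rightarrow> real) \<Rightarrow> real" where
  "form v = (\<Sum>y\<in>UNIV. \<Sum>z\<in>UNIV. v y * v z * m (d y z))"

lemma form_eq:
  assumes "\<And>y z. m (d y z) = \<mu> * (\<Sum>w\<in>UNIV. m (d y w) * m (d z w))"
  shows "form v = \<mu> * (\<Sum>w\<in>UNIV. (\<Sum>y\<in>UNIV. v y * m (d y w))\<^sup>2)"
proof -
  have "form v = (\<Sum>y\<in>UNIV. \<Sum>z\<in>UNIV. \<Sum>w\<in>UNIV. \<mu> * ((v y * m (d y w)) * (v z * m (d z w))))"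
    unfolding form_def by (subst assms) (simp add: sum_distrib_left algebra_simps)
  also have "\<dots> = (\<Sum>y\<in>UNIV. \<Sum>w\<in>UNIV. \<Sum>z\<in>UNIV. \<mu> * ((v y * m (d y w)) * (v z * m (d z w))))"
    by (intro sum.cong refl sum.swap)
  also have "\<dots> = (\<Sum>w\<in>UNIV. \<Sum>y\<in>UNIV. \<Sum>z\<in>UNIV. \<mu> * ((v y * m (d y w)) * (v z * m (d z w))))"
    by (rule sum.swap)
  also have "\<dots> = \<mu> * (\<Sum>w\<in>UNIV. (\<Sum>y\<in>UNIV. v y * m (d y w))\<^sup>2)"
    unfolding power2_eq_square sum_product by (simp only: sum_distrib_left)
  finally show ?thesis .
qed

lemma form_nonneg:
  assumes "d y\<^sub>0 z\<^sub>0 = 1" shows "form v \<ge> 0"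
proof -
  obtain \<mu> where "\<mu> > 0" and \<mu>: "\<And>y z. m (d y z) = \<mu> * (\<Sum>w\<in>UNIV. m (d y w) * m (d z w))"
    using m_idempotent [OF assms] by blast
  have "form v = \<mu> * (\<Sum>w\<in>UNIV. (\<Sum>y\<in>UNIV. v y * m (d y w))\<^sup>2)" by (rule form_eq) (rule \<mu>)
  then show ?thesis using \<open>\<mu> > 0\<close> by (simp add: sum_nonneg)
qed

lemma form_zeroD:
  assumes "d y\<^sub>0 z\<^sub>0 = 1" "form v = 0" shows "(\<Sum>y\<in>UNIV. v y * m (d y w)) = 0"
proof -
  obtain \<mu> where "\<mu> > 0" and \<mu>: "\<And>y z. m (d y z) = \<mu> * (\<Sum>w\<in>UNIV. m (d y w) * m (d z w))"
    using m_idempotent [OF assms(1)] by blast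
  have "form v = \<mu> * (\<Sum>w\<in>UNIV. (\<Sum>y\<in>UNIV. v y * m (d y w))\<^sup>2)" by (rule form_eq) (rule \<mu>)
  then have "(\<Sum>w\<in>UNIV. (\<Sum>y\<in>UNIV. v y * m (d y w))\<^sup>2) = 0" using assms(2) \<open>\<mu> > 0\<close> by simp
  then show ?thesis by (simp add: sum_nonneg_eq_0_iff)
qed

text \<open>The constant \<open>\<kappa>\<close> contributes only a multiple of the coordinate sum,
  so on such vectors powers of \<open>s\<close> suffice.\<close>

lemma form_sum_zero:
  assumes "(\<Sum>y\<in>UNIV. v y) = 0"
  shows "form v = (\<Sum>z\<in>UNIV. v z * (\<Sum>y\<in>UNIV. v y * s ^ d y z))"
proof -
  have "form v = (\<Sum>z\<in>UNIV. \<Sum>y\<in>UNIV. v y * v z * m (d y z))"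
    unfolding form_def by (rule sum.swap)
  also have "\<dots> = (\<Sum>z\<in>UNIV. v z * (\<Sum>y\<in>UNIV. v y * s ^ d y z) + \<kappa> * v z * (\<Sum>y\<in>UNIV. v y))"
    unfolding sum_distrib_left sum.distrib [symmetric]
    by (intro sum.cong refl) (simp_all add: m_def algebra_simps)
  finally show ?thesis using assms by simp
qed

lemma kernel_sum_zero:
  assumes "d y\<^sub>0 z\<^sub>0 = 1" "(\<Sum>y\<in>UNIV. v y) = 0" "form v = 0"
  shows "(\<Sum>y\<in>UNIV. v y * s ^ d y w) = 0"
proof -
  have "(\<Sum>y\<in>UNIV. v y * m (d y w)) = (\<Sum>y\<in>UNIV. v y * s ^ d y w) + \<kappa> * (\<Sum>y\<in>UNIV. v y)"
    unfolding sum_distrib_left sum.distrib [symmetric]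
    by (intro sum.cong refl) (simp_all add: m_def algebra_simps)
  then show ?thesis using form_zeroD [OF assms(1,3), of w] assms(2) by simp
qed

section \<open>Parallelograms\<close>

lemma dist_common_neighbour:
  assumes "d y a = 1" "d y w = 1" "a \<noteq> w" shows "d w a = 2"
proof -
  have "d w a \<noteq> 0" "d w a \<noteq> 1" using assms triangle_free [of y w a] by auto
  moreover have "d w a \<le> 2" using triangle [of w a y] assms sym [of w y] by simp
  ultimately show ?thesis by linarith
qed

text \<open>Without triangles distinct neighbours of \<open>y\<close> are at distance 2, so apart
  from \<open>w\<close> itself all terms agree.\<close>

lemma same_side_sum:
  fixes f :: "nat \<Rightarrow> real"
  assumes yz: "d y z = Suc h" and w: "d y w = 1" "d z w = h"
  shows "(\<Sum>a | d y a = 1 \<and> d z a = h. f (d w a)) = f 0 + (c (Suc h) - 1) * f 2"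
proof -
  let ?S = "{a. d y a = 1 \<and> d z a = h}"
  have "(\<Sum>a\<in>?S. f (d w a)) = f (d w w) + (\<Sum>a\<in>?S - {w}. f (d w a))"
    using w by (intro sum.remove) auto
  also have "(\<Sum>a\<in>?S - {w}. f (d w a)) = (\<Sum>a\<in>?S - {w}. f 2)"
    using w by (intro sum.cong refl arg_cong [where f = f] dist_common_neighbour [of y]) auto
  also have "\<dots> = (real (card ?S) - 1) * f 2"
    using card.remove [of ?S w] w by simp
  finally show ?thesis using card_c [OF yz] by simp
qed

text \<open>The distance from \<open>w\<close> to \<open>a\<close> takes three values. The vertices
  at distance h are all the c_{h+1} neighbours of \<open>z\<close> nearest to \<open>w\<close>, as
  these are automatically closer to \<open>y\<close>. The vertices at distance h + 1 complete
  parallelograms of length h + 2; their number is the only unknown.\<close>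

lemma cross_sum:
  fixes f :: "nat \<Rightarrow> real"
  assumes yz: "d y z = Suc (Suc h)" and w: "d y w = 1" "d z w = Suc h"
  shows "(\<Sum>a | d z a = 1 \<and> d y a = Suc h. f (d w a)) = c (Suc h) * f h
    + real (card {a. d z a = 1 \<and> d y a = Suc h \<and> d w a = Suc h}) * (f (Suc h) - f (Suc (Suc h)))
    + (c (Suc (Suc h)) - c (Suc h)) * f (Suc (Suc h))"
proof -
  let ?T = "{a. d z a = 1 \<and> d y a = Suc h}"
  have far: "d w a = h \<or> d w a = Suc h \<or> d w a = Suc (Suc h)" if "d z a = 1" for a
    using dist_neighbour [of z a w] that w sym [of w z] by auto
  have "(\<Sum>a\<in>?T. f (d w a)) = (\<Sum>a\<in>?T. f (Suc (Suc h)) + of_bool (d w a = h) * (f h - f (Suc (Suc h)))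
          + of_bool (d w a = Suc h) * (f (Suc h) - f (Suc (Suc h))))"
  proof (rule sum.cong [OF refl])
    fix a assume "a \<in> ?T"
    then show "f (d w a) = f (Suc (Suc h)) + of_bool (d w a = h) * (f h - f (Suc (Suc h)))
          + of_bool (d w a = Suc h) * (f (Suc h) - f (Suc (Suc h)))"
      using far [of a] by auto
  qed
  also have "\<dots> = real (card ?T) * f (Suc (Suc h))
      + real (card {a\<in>?T. d w a = h}) * (f h - f (Suc (Suc h)))
      + real (card {a\<in>?T. d w a = Suc h}) * (f (Suc h) - f (Suc (Suc h)))"
    by (simp add: sum.distrib sum_constant_fibre del: sum_of_bool_mult_eq)
  also have "real (card ?T) = c (Suc (Suc h))"
    using card_c [of z y "Suc h"] yz sym [of z y] by simp
  also have "{a\<in>?T. d w a = h} = {a. d z a = 1 \<and> d w a = h}"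
  proof -
    have "d y a = Suc h" if "d z a = 1" "d w a = h" for a
      using triangle [of y z a] triangle [of y a w] that w yz sym [of z a] by simp
    then show ?thesis by auto
  qed
  also have "real (card \<dots>) = c (Suc h)" using card_c [OF w(2)] .
  also have "{a\<in>?T. d w a = Suc h} = {a. d z a = 1 \<and> d y a = Suc h \<and> d w a = Suc h}" by auto
  finally show ?thesis by (simp add: algebra_simps)
qed

text \<open>This is q c_3 / (1 + q + q^2), the solution of \<open>balance_tau\<close>: the
  coefficient for which the kernel vector is orthogonal, in the form of M, to both end points
  \<open>y\<close> and \<open>z\<close>.\<close>

definition \<tau> :: real where "\<tau> = q * (1 + \<alpha> * (1 + q))"

lemma c_simps:
  "c 0 = 0" "c (Suc 0) = 1" "c 2 = (1 + q) * (1 + \<alpha>)" "c 3 = (1 + q + q\<^sup>2) * (1 + \<alpha> * (1 + q))"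
  "c 4 = (1 + q) * (1 + q\<^sup>2) * (1 + \<alpha> * (1 + q + q\<^sup>2))"
  using gauss_simps(4) [of q] gauss_simps(3) [of q]
  by (simp_all add: c_def)

text \<open>The pairing of the kernel vector with a neighbour \<open>w\<close> of an end point in
  the absence of parallelograms. That the value of \<open>\<tau>\<close> forced by the end points
  makes this vanish too leaves only the parallelogram count in the norm.\<close>

lemma balance_constant: "1 + (c 3 - 1) * s\<^sup>2 - (c 2 * s + (c 3 - c 2) * s ^ 3) - \<tau> * (s - s\<^sup>2) = 0"
proof -
  have s: "s = 1 / q" "q \<noteq> 0" using q_less by (auto simp: s_def)
  show ?thesis unfolding s(1) c_simps \<tau>_def using s(2)
    by (simp add: divide_simps) (simp add: algebra_simps power2_eq_square power3_eq_cube)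
qed

lemma balance_tau: "c 3 * (s - s\<^sup>2) = \<tau> * (1 - s ^ 3)"
proof -
  have s: "s = 1 / q" "q \<noteq> 0" using q_less by (auto simp: s_def)
  show ?thesis unfolding s(1) c_simps \<tau>_def using s(2)
    by (simp add: divide_simps) (simp add: algebra_simps power2_eq_square power3_eq_cube)
qed

text \<open>The squared norm of the vector in the kernel is a negative multiple of the number of
  parallelograms of length three through \<open>y\<close> and \<open>z\<close>, because \<open>s\<^sup>2 - s\<^sup>3 > 0\<close>.\<close>

lemma
  assumes yz: "d y z = 3"
  shows balanced_3: "(\<Sum>w | d y w = 1 \<and> d z w = 2. s ^ d w x) - (\<Sum>w | d z w = 1 \<and> d y w = 2. s ^ d w x)
      = \<tau> * (s ^ d y x - s ^ d z x)"
    and no_parallelogram_3: "d y w = 1 \<Longrightarrow> d z w = 2 \<Longrightarrow> d z a = 1 \<Longrightarrow> d y a = 2 \<Longrightarrow> d w a \<noteq> 2"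
proof -
  let ?S = "{w. d y w = 1 \<and> d z w = 2}" and ?T = "{w. d z w = 1 \<and> d y w = 2}"
  define v where "v w = of_bool (w \<in> ?S) - of_bool (w \<in> ?T) - \<tau> * (of_bool (w = y) - of_bool (w = z))" for w
  have v: "(\<Sum>w\<in>UNIV. v w * f w) = (\<Sum>w\<in>?S. f w) - (\<Sum>w\<in>?T. f w) - \<tau> * (f y - f z)" for f
  proof -
    have "(\<Sum>w\<in>UNIV. v w * f w) = (\<Sum>w\<in>UNIV. of_bool (w \<in> ?S) * f w) - (\<Sum>w\<in>UNIV. of_bool (w \<in> ?T) * f w)
        - ((\<Sum>w\<in>UNIV. of_bool (w = y) * (\<tau> * f w)) - (\<Sum>w\<in>UNIV. of_bool (w = z) * (\<tau> * f w)))"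
      unfolding v_def left_diff_distrib sum_subtractf
      by (simp only: sum_distrib_left mult.assoc right_diff_distrib left_diff_distrib sum_subtractf mult.left_commute [of _ \<tau>])
    then show ?thesis by (simp add: Int_def right_diff_distrib)
  qed
  define n where "n w = real (card {a\<in>?T. d w a = 2})" for w
  define n' where "n' w = real (card {a\<in>?S. d w a = 2})" for w
  define \<phi> where "\<phi> w = (\<Sum>a\<in>UNIV. v a * s ^ d a w)" for w
  have zy: "d z y = 3" using yz sym by simp
  have cards: "real (card ?S) = c 3" "real (card ?T) = c 3"
    using card_c [of y z 2] card_c [of z y 2] yz zy by simp_all
  have \<phi>: "\<phi> w = (\<Sum>a\<in>?S. s ^ d w a) - (\<Sum>a\<in>?T. s ^ d w a) - \<tau> * (s ^ d w y - s ^ d w z)" for w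
    unfolding \<phi>_def v using sym [of _ w] by simp
  have S: "\<phi> w = - (s\<^sup>2 - s ^ 3) * n w" if "w \<in> ?S" for w
  proof -
    have w: "d y w = 1" "d z w = 2" "d w y = 1" "d w z = 2" using that sym by auto
    have "(\<Sum>a\<in>?S. s ^ d w a) = 1 + (c 3 - 1) * s\<^sup>2"
      using same_side_sum [of y z 2 w "\<lambda>j. s ^ j"] yz w by simp
    moreover have "(\<Sum>a\<in>?T. s ^ d w a) = c 2 * s + n w * (s\<^sup>2 - s ^ 3) + (c 3 - c 2) * s ^ 3"
      using cross_sum [of y z 1 w "\<lambda>j. s ^ j"] yz w by (simp add: n_def eval_nat_numeral conj_assoc)
    ultimately show ?thesis unfolding \<phi> w using balance_constant by (simp add: algebra_simps)
  qed
  have T: "\<phi> w = (s\<^sup>2 - s ^ 3) * n' w" if "w \<in> ?T" for w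
  proof -
    have w: "d z w = 1" "d y w = 2" "d w z = 1" "d w y = 2" using that sym by auto
    have "(\<Sum>a\<in>?T. s ^ d w a) = 1 + (c 3 - 1) * s\<^sup>2"
      using same_side_sum [of z y 2 w "\<lambda>j. s ^ j"] zy w by simp
    moreover have "(\<Sum>a\<in>?S. s ^ d w a) = c 2 * s + n' w * (s\<^sup>2 - s ^ 3) + (c 3 - c 2) * s ^ 3"
      using cross_sum [of z y 1 w "\<lambda>j. s ^ j"] zy w by (simp add: n'_def eval_nat_numeral conj_assoc)
    ultimately show ?thesis unfolding \<phi> w using balance_constant by (simp add: algebra_simps)
  qed
  have y: "\<phi> y = 0" unfolding \<phi> using yz cards balance_tau by (simp add: algebra_simps)
  have z: "\<phi> z = 0" unfolding \<phi> using zy cards balance_tau by (simp add: algebra_simps)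
  have sum0: "(\<Sum>w\<in>UNIV. v w) = 0" using v [of "\<lambda>_. 1"] cards by simp
  have edge: "\<exists>w. d y w = 1" using geodesic [of y z 2] yz by auto
  then obtain y' where y': "d y y' = 1" by blast
  \<comment> \<open>The norm is the pairing of \<open>v\<close> with \<open>\<phi>\<close>. The end
    points contribute nothing; \<open>\<phi>\<close> has opposite signs on the two sides, as has
    \<open>v\<close>, so both sides contribute with the same negative sign.\<close>
  have "form v = (\<Sum>w\<in>?S. \<phi> w) - (\<Sum>w\<in>?T. \<phi> w)"
    using v [of \<phi>] y z unfolding form_sum_zero [OF sum0] \<phi>_def by simp
  also have "\<dots> = - (s\<^sup>2 - s ^ 3) * ((\<Sum>w\<in>?S. n w) + (\<Sum>w\<in>?T. n' w))"
  proof -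
    have "(\<Sum>w\<in>?S. \<phi> w) = - (s\<^sup>2 - s ^ 3) * (\<Sum>w\<in>?S. n w)"
      unfolding sum_distrib_left using S by (intro sum.cong) auto
    moreover have "(\<Sum>w\<in>?T. \<phi> w) = (s\<^sup>2 - s ^ 3) * (\<Sum>w\<in>?T. n' w)"
      unfolding sum_distrib_left using T by (intro sum.cong) auto
    ultimately show ?thesis by (simp add: algebra_simps)
  qed
  finally have form: "form v = - (s\<^sup>2 - s ^ 3) * ((\<Sum>w\<in>?S. n w) + (\<Sum>w\<in>?T. n' w))" .
  have pos: "s\<^sup>2 - s ^ 3 > 0" 
  proof -
    have "s\<^sup>2 - s ^ 3 = s\<^sup>2 * (1 - s)" by (simp add: algebra_simps power2_eq_square power3_eq_cube)
    also have "\<dots> > 0" using s_bounds by (intro mult_pos_pos) auto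
    finally show ?thesis .
  qed
  have nonneg: "(\<Sum>w\<in>?S. n w) \<ge> 0" "(\<Sum>w\<in>?T. n' w) \<ge> 0"
    by (simp_all add: n_def n'_def sum_nonneg)
  have total: "(\<Sum>w\<in>?S. n w) + (\<Sum>w\<in>?T. n' w) \<le> 0"
  proof (rule ccontr)
    assume "\<not> ?thesis"
    then have "form v < 0" unfolding form using pos by (simp only: mult_neg_pos neg_less_0_iff_less not_le)
    then show False using form_nonneg [OF y', of v] by simp
  qed
  then have "form v = 0" unfolding form using nonneg by simp
  from kernel_sum_zero [OF y' sum0 this, of x]
  show "(\<Sum>w\<in>?S. s ^ d w x) - (\<Sum>w\<in>?T. s ^ d w x) = \<tau> * (s ^ d y x - s ^ d z x)"
    unfolding v by simp
  show "d w a \<noteq> 2" if w: "d y w = 1" "d z w = 2" and a: "d z a = 1" "d y a = 2" for w a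
  proof
    assume "d w a = 2"
    then have "n w > 0" unfolding n_def using a by (auto simp: card_gt_0_iff)
    moreover have "n w \<le> (\<Sum>w\<in>?S. n w)" using w by (intro member_le_sum) (auto simp: n_def)
    ultimately show False using total nonneg by linarith
  qed
qed

lemma c_pos:
  assumes "d y z = Suc h" shows "c (Suc h) > 0"
proof -
  obtain w where w: "d y w = 1" "d w z = h" using geodesic [OF assms] by blast
  then have "w \<in> {u. d y u = 1 \<and> d z u = h}" using sym by auto
  then have "card {u. d y u = 1 \<and> d z u = h} > 0" by (auto simp: card_gt_0_iff)
  then show ?thesis using card_c [OF assms] by simp
qed

text \<open>After exchanging the sums, \<open>w\<close> must be at distance 3 from \<open>z\<close>,
  and it is counted once for each of the c_3 neighbours of \<open>z\<close> at distance 2 from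
  it.\<close>

lemma double_sum_near:
  fixes f :: "'v \<Rightarrow> real"
  assumes yz: "d y z = 4"
  shows "(\<Sum>a | d z a = 1 \<and> d y a = 3. \<Sum>w | d y w = 1 \<and> d a w = 2. f w)
    = c 3 * (\<Sum>w | d y w = 1 \<and> d z w = 3. f w)"
proof -
  let ?U = "{a. d z a = 1 \<and> d y a = 3}" and ?W = "{w. d y w = 1}"
  have zy: "d z y = 4" using yz sym by simp
  have "(\<Sum>a\<in>?U. \<Sum>w | d y w = 1 \<and> d a w = 2. f w) = (\<Sum>a\<in>?U. \<Sum>w | w \<in> ?W \<and> d a w = 2. f w)"
    by simp
  also have "\<dots> = (\<Sum>w\<in>?W. \<Sum>a | a \<in> ?U \<and> d a w = 2. f w)"
    by (rule sum.swap_restrict) auto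
  also have "\<dots> = (\<Sum>w\<in>?W. of_bool (d z w = 3) * (c 3 * f w))"
  proof (rule sum.cong [OF refl])
    fix w assume "w \<in> ?W"
    then have w: "d y w = 1" "d w y = 1" using sym by auto
    have *: "d z w = 3 \<and> d y a = 3" if "d z a = 1" "d a w = 2" for a
      using triangle [of z y a] triangle [of a y w] triangle [of z w a] triangle [of z y w] zy w that sym [of y a]
        triangle [of y a w] triangle [of y z a] sym [of a z] sym [of a w]
      by simp
    show "(\<Sum>a | a \<in> ?U \<and> d a w = 2. f w) = of_bool (d z w = 3) * (c 3 * f w)"
    proof (cases "d z w = 3")
      case True
      have "{a. a \<in> ?U \<and> d a w = 2} = {a. d z a = 1 \<and> d w a = 2}" using * sym by auto
      then show ?thesis using card_c [of z w 2] True by simp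
    next
      case False
      then have "{a. a \<in> ?U \<and> d a w = 2} = {}" using * by auto
      then show ?thesis using False by simp
    qed
  qed
  also have "\<dots> = c 3 * (\<Sum>w | d y w = 1 \<and> d z w = 3. f w)"
    by (simp add: sum_distrib_left Collect_conj_eq [symmetric])
  finally show ?thesis .
qed

text \<open>After exchanging the sums, each \<open>w\<close> halfway between \<open>y\<close> and
  \<open>z\<close> is counted once for each of its c_2 common neighbours with \<open>z\<close>. The
  result is symmetric in \<open>y\<close> and \<open>z\<close>.\<close>

lemma double_sum_middle:
  fixes f :: "'v \<Rightarrow> real"
  assumes yz: "d y z = 4"
  shows "(\<Sum>a | d z a = 1 \<and> d y a = 3. \<Sum>w | d a w = 1 \<and> d y w = 2. f w)
    = c 2 * (\<Sum>w | d y w = 2 \<and> d z w = 2. f w)"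
proof -
  let ?U = "{a. d z a = 1 \<and> d y a = 3}" and ?W = "{w. d y w = 2}"
  have zy: "d z y = 4" using yz sym by simp
  have "(\<Sum>a\<in>?U. \<Sum>w | d a w = 1 \<and> d y w = 2. f w) = (\<Sum>a\<in>?U. \<Sum>w | w \<in> ?W \<and> d a w = 1. f w)"
    by (simp add: conj_commute)
  also have "\<dots> = (\<Sum>w\<in>?W. \<Sum>a | a \<in> ?U \<and> d a w = 1. f w)"
    by (rule sum.swap_restrict) auto
  also have "\<dots> = (\<Sum>w\<in>?W. of_bool (d z w = 2) * (c 2 * f w))"
  proof (rule sum.cong [OF refl])
    fix w assume "w \<in> ?W"
    then have w: "d y w = 2" "d w y = 2" using sym by auto
    have *: "d z w = 2 \<and> d y a = 3" if "d z a = 1" "d a w = 1" for a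
      using triangle [of z w a] triangle [of z y w] triangle [of y a w] triangle [of y z a] zy w yz that sym [of a z] sym [of a w]
      by simp
    show "(\<Sum>a | a \<in> ?U \<and> d a w = 1. f w) = of_bool (d z w = 2) * (c 2 * f w)"
    proof (cases "d z w = 2")
      case True
      have "{a. a \<in> ?U \<and> d a w = 1} = {a. d z a = 1 \<and> d w a = 1}" using * sym by auto
      then show ?thesis using card_c [of z w 1] True by (simp add: numeral_2_eq_2)
    next
      case False
      then have "{a. a \<in> ?U \<and> d a w = 1} = {}" using * by auto
      then show ?thesis using False by simp
    qed
  qed
  also have "\<dots> = c 2 * (\<Sum>w | d y w = 2 \<and> d z w = 2. f w)"
    by (simp add: sum_distrib_left Collect_conj_eq [symmetric])
  finally show ?thesis .
qed

text \<open>Summing the relation at distance three over the neighbours of either end point; the middle terms cancel.\<close>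

lemma balanced_4:
  assumes yz: "d y z = 4"
  shows "(c 3 - \<tau>) * ((\<Sum>w | d y w = 1 \<and> d z w = 3. s ^ d w x) - (\<Sum>w | d z w = 1 \<and> d y w = 3. s ^ d w x))
    = \<tau> * c 4 * (s ^ d y x - s ^ d z x)"
proof -
  define f where "f w = s ^ d w x" for w
  let ?V = "{w. d y w = 1 \<and> d z w = 3}" and ?U = "{w. d z w = 1 \<and> d y w = 3}"
  have zy: "d z y = 4" using yz sym by simp
  have cards: "real (card ?U) = c 4" "real (card ?V) = c 4"
    using card_c [of z y 3] card_c [of y z 3] yz zy by simp_all
  have "(\<Sum>a\<in>?U. (\<Sum>w | d y w = 1 \<and> d a w = 2. f w) - (\<Sum>w | d a w = 1 \<and> d y w = 2. f w))
      = (\<Sum>a\<in>?U. \<tau> * (f y - f a))"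
    unfolding f_def by (intro sum.cong refl balanced_3) auto
  then have U: "c 3 * (\<Sum>w\<in>?V. f w) - c 2 * (\<Sum>w | d y w = 2 \<and> d z w = 2. f w)
      = \<tau> * (c 4 * f y - (\<Sum>w\<in>?U. f w))"
    unfolding sum_subtractf double_sum_near [OF yz] double_sum_middle [OF yz]
    by (simp add: cards [simplified] sum_subtractf flip: sum_distrib_left)
  have "(\<Sum>a\<in>?V. (\<Sum>w | d z w = 1 \<and> d a w = 2. f w) - (\<Sum>w | d a w = 1 \<and> d z w = 2. f w))
      = (\<Sum>a\<in>?V. \<tau> * (f z - f a))"
    unfolding f_def by (intro sum.cong refl balanced_3) auto
  then have "c 3 * (\<Sum>w\<in>?U. f w) - c 2 * (\<Sum>w | d z w = 2 \<and> d y w = 2. f w)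
      = \<tau> * (c 4 * f z - (\<Sum>w\<in>?V. f w))"
    unfolding sum_subtractf double_sum_near [OF zy] double_sum_middle [OF zy]
    by (simp add: cards [simplified] sum_subtractf flip: sum_distrib_left)
  then have V: "c 3 * (\<Sum>w\<in>?U. f w) - c 2 * (\<Sum>w | d y w = 2 \<and> d z w = 2. f w)
      = \<tau> * (c 4 * f z - (\<Sum>w\<in>?V. f w))"
    by (simp add: conj_commute)
  from U V show ?thesis unfolding f_def [symmetric] by (simp add: algebra_simps)
qed

lemma balance_constant_4:
  "(c 3 - \<tau>) * (1 + (c 4 - 1) * s\<^sup>2 - (c 3 * s\<^sup>2 + (c 4 - c 3) * s ^ 4)) = \<tau> * c 4 * (s - s ^ 3)"
proof -
  have s: "s = 1 / q" "q \<noteq> 0" using q_less by (auto simp: s_def)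
  show ?thesis unfolding s(1) c_simps \<tau>_def using s(2)
    by (simp add: divide_simps) (simp add: algebra_simps eval_nat_numeral)
qed

text \<open>The relation \<open>balanced_4\<close>, evaluated at \<open>w\<close> itself, has the
  parallelogram count as its only unknown, and by \<open>balance_constant_4\<close> the other terms
  cancel. So no second norm computation is made.\<close>

lemma no_parallelogram_4:
  assumes yz: "d y z = 4" and w: "d y w = 1" "d z w = 3" and a: "d z a = 1" "d y a = 3"
  shows "d w a \<noteq> 3"
proof -
  have w': "d w y = 1" "d w z = 3" using w sym by auto
  define n where "n = real (card {a. d z a = 1 \<and> d y a = 3 \<and> d w a = 3})"
  have 1: "(\<Sum>a | d y a = 1 \<and> d z a = 3. s ^ d a w) = 1 + (c 4 - 1) * s\<^sup>2"
    using same_side_sum [of y z 3 w "\<lambda>j. s ^ j"] yz w sym [of w] by simp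
  have 2: "(\<Sum>a | d z a = 1 \<and> d y a = 3. s ^ d a w) = c 3 * s\<^sup>2 + n * (s ^ 3 - s ^ 4) + (c 4 - c 3) * s ^ 4"
    using cross_sum [of y z 2 w "\<lambda>j. s ^ j"] yz w sym [of w] by (simp add: n_def)
  have "(c 3 - \<tau>) * (n * (s ^ 3 - s ^ 4)) = 0"
    using balanced_4 [OF yz, of w] balance_constant_4
    unfolding 1 2 w power_one_right by (simp add: algebra_simps)
  \<comment> \<open>Both \<open>c 3\<close> and \<open>c 3 - \<tau>\<close> are multiples of 1 +
    \<alpha> (1 + q), which is nonzero because c_3 counts a nonempty set.\<close>
  moreover have "c 3 - \<tau> \<noteq> 0"
  proof -
    have "c 3 > 0" using c_pos [of z w 2] w by simp
    moreover have "c 3 - \<tau> = (1 + q\<^sup>2) * (1 + \<alpha> * (1 + q))" "c 3 = (1 + q + q\<^sup>2) * (1 + \<alpha> * (1 + q))"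
      by (simp_all add: c_simps \<tau>_def algebra_simps)
    ultimately show ?thesis by (smt (verit) mult_eq_0_iff zero_le_power2)
  qed
  moreover have "s ^ 3 - s ^ 4 \<noteq> 0" using s_bounds by (simp add: eval_nat_numeral)
  ultimately have "n = 0" by simp
  then show ?thesis using a by (auto simp: n_def)
qed

section \<open>The Krein bound\<close>

text \<open>The numbers c_h and b_h are quadratic polynomials in q^h, so multiplying by s^(2h) gives
  a combination of s^(2h), s^h and 1. The case h = 0 fixes the first coefficient in terms of the
  other two.\<close>

lemma recurrence_s2:
  defines "y2 \<equiv> (q + 1) * (1 + q\<^sup>2 - \<alpha> * (1 + q)) / q\<^sup>2" and "z2 \<equiv> (q + 1) * \<alpha> / q\<^sup>2"
  shows "c h * (s ^ (h - 1))\<^sup>2 + (k - c h - b h) * (s ^ h)\<^sup>2 + b h * (s ^ Suc h)\<^sup>2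
    = (k * s\<^sup>2 - y2 - z2) * (s ^ h)\<^sup>2 + y2 * s ^ h + z2"
proof (cases h)
  case 0 then show ?thesis by (simp add: c_def b_def algebra_simps)
next
  case (Suc j)
  define t where "t = q ^ j"
  define u where "u = s ^ j"
  have tu: "t * u = 1" by (simp add: t_def u_def q_power_s)
  define g where "g = gauss q j"
  have g: "t = 1 + (q - 1) * g" by (simp add: t_def g_def gauss_closed)
  have g': "gauss q (Suc j) = 1 + q * g"
    by (simp add: g_def gauss_def lessThan_Suc_atMost sum.atMost_shift sum_distrib_left del: sum.lessThan_Suc)
  have cb: "c h = (1 + q * g) * (1 + \<alpha> * g)" "b h = k - (1 + q * g) * (1 - \<alpha> * q * g)"
    by (simp_all add: c_def b_def Suc g' flip: g_def) (simp add: algebra_simps)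
  have q: "q \<noteq> 0" using q_less by auto
  have "c h + (k - c h - b h) * (1 / q)\<^sup>2 + b h * (1 / q) ^ 4
    = (k * (1 / q)\<^sup>2 - y2 - z2) * (1 / q)\<^sup>2 + y2 * (1 / q) * t + z2 * t\<^sup>2"
    unfolding y2_def z2_def cb g using q
    by (simp add: divide_simps) (simp add: algebra_simps eval_nat_numeral)
  then have "(c h + (k - c h - b h) * s\<^sup>2 + b h * s ^ 4) * u\<^sup>2
    = ((k * s\<^sup>2 - y2 - z2) * s\<^sup>2 + y2 * s * t + z2 * t\<^sup>2) * u\<^sup>2"
    by (simp add: s_def)
  also have "\<dots> = (k * s\<^sup>2 - y2 - z2) * (s * u)\<^sup>2 + y2 * (s * u) * (t * u) + z2 * (t * u)\<^sup>2"
    by (simp add: algebra_simps power2_eq_square)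
  finally have "c h * u\<^sup>2 + (k - c h - b h) * (s * u)\<^sup>2 + b h * (s * (s * u))\<^sup>2
    = (k * s\<^sup>2 - y2 - z2) * (s * u)\<^sup>2 + y2 * (s * u) + z2"
    unfolding tu by (simp add: algebra_simps eval_nat_numeral)
  then show ?thesis using Suc by (simp add: u_def)
qed

text \<open>The Schur product argument: replacing two of the three factors by M = \<mu> M M turns
  the sum into a nonnegative combination of values of the form.\<close>

lemma sum_m_cube_nonneg:
  assumes "d y\<^sub>0 z\<^sub>0 = 1"
  shows "(\<Sum>y\<in>UNIV. \<Sum>z\<in>UNIV. m (d y z) ^ 3) \<ge> 0"
proof -
  obtain \<mu> where "\<mu> > 0" and \<mu>: "\<And>y z. m (d y z) = \<mu> * (\<Sum>w\<in>UNIV. m (d y w) * m (d z w))"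
    using m_idempotent [OF assms] by blast
  define g where "g w w' y = m (d y w) * m (d y w')" for w w' y
  have cube: "m (d y z) ^ 3 = (\<Sum>w\<in>UNIV. \<Sum>w'\<in>UNIV. \<mu>\<^sup>2 * (g w w' y * g w w' z * m (d y z)))" for y z
  proof -
    have "m (d y z) ^ 3 = m (d y z) * m (d y z) * m (d y z)" by (simp add: power3_eq_cube)
    also have "\<dots> = (\<mu> * (\<Sum>w\<in>UNIV. m (d y w) * m (d z w))) * (\<mu> * (\<Sum>w\<in>UNIV. m (d y w) * m (d z w))) * m (d y z)"
      using \<mu> [of y z] by presburger
    also have "\<dots> = \<mu>\<^sup>2 * ((\<Sum>w\<in>UNIV. m (d y w) * m (d z w)) * (\<Sum>w'\<in>UNIV. m (d y w') * m (d z w'))) * m (d y z)"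
      by (simp add: power2_eq_square algebra_simps)
    also have "\<dots> = (\<Sum>w\<in>UNIV. \<Sum>w'\<in>UNIV. \<mu>\<^sup>2 * (g w w' y * g w w' z * m (d y z)))"
      unfolding sum_product sum_distrib_left sum_distrib_right g_def by (simp only: ac_simps)
    finally show ?thesis .
  qed
  have "(\<Sum>y\<in>UNIV. \<Sum>z\<in>UNIV. m (d y z) ^ 3)
      = (\<Sum>y\<in>UNIV. \<Sum>w\<in>UNIV. \<Sum>z\<in>UNIV. \<Sum>w'\<in>UNIV. \<mu>\<^sup>2 * (g w w' y * g w w' z * m (d y z)))"
    unfolding cube by (intro sum.cong refl sum.swap)
  also have "\<dots> = (\<Sum>w\<in>UNIV. \<Sum>y\<in>UNIV. \<Sum>z\<in>UNIV. \<Sum>w'\<in>UNIV. \<mu>\<^sup>2 * (g w w' y * g w w' z * m (d y z)))"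
    by (rule sum.swap)
  also have "\<dots> = (\<Sum>w\<in>UNIV. \<Sum>y\<in>UNIV. \<Sum>w'\<in>UNIV. \<Sum>z\<in>UNIV. \<mu>\<^sup>2 * (g w w' y * g w w' z * m (d y z)))"
    by (intro sum.cong refl sum.swap)
  also have "\<dots> = (\<Sum>w\<in>UNIV. \<Sum>w'\<in>UNIV. \<Sum>y\<in>UNIV. \<Sum>z\<in>UNIV. \<mu>\<^sup>2 * (g w w' y * g w w' z * m (d y z)))"
    by (intro sum.cong refl sum.swap)
  also have "\<dots> = (\<Sum>w\<in>UNIV. \<Sum>w'\<in>UNIV. \<mu>\<^sup>2 * form (g w w'))"
    unfolding form_def by (simp only: sum_distrib_left)
  also have "\<dots> \<ge> 0" by (intro sum_nonneg mult_nonneg_nonneg form_nonneg [OF assms]) auto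
  finally show ?thesis .
qed

text \<open>Pairing the eigenfunction m with the squares s^(2d) and moving the adjacency matrix
  across gives \<open>(\<theta> - \<theta>2) * E2 = y2 * E1\<close>, since m is orthogonal to
  constants. The sums of squares and cubes of m are combinations of \<open>E1\<close> and
  \<open>E2\<close>.\<close>

lemma sum_m_cube:
  defines "y2 \<equiv> (q + 1) * (1 + q\<^sup>2 - \<alpha> * (1 + q)) / q\<^sup>2" and "z2 \<equiv> (q + 1) * \<alpha> / q\<^sup>2"
  shows "(\<theta> - (k * s\<^sup>2 - y2 - z2)) * (\<Sum>y\<in>UNIV. m (d z y) ^ 3)
    = (y2 + 2 * \<kappa> * (\<theta> - (k * s\<^sup>2 - y2 - z2))) * (\<Sum>y\<in>UNIV. (m (d z y))\<^sup>2)"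
proof -
  define \<theta>2 where "\<theta>2 = k * s\<^sup>2 - y2 - z2"
  define E0 where "E0 = (\<Sum>y\<in>UNIV. m (d z y))"
  define E1 where "E1 = (\<Sum>y\<in>UNIV. m (d z y) * s ^ d z y)"
  define E2 where "E2 = (\<Sum>y\<in>UNIV. m (d z y) * (s ^ d z y)\<^sup>2)"
  have "k * E0 = \<theta> * E0"
    using adjacency_self_adjoint [of "\<lambda>y. m (d z y)" "\<lambda>_. 1"]
    unfolding m_neighbour_sum sum_constant valency E0_def
    by (simp add: valency [simplified] sym [of _ z] mult.commute flip: sum_distrib_left)
  then have E0: "E0 = 0" using theta_less by simp
  have nb: "(\<Sum>w | d y w = 1. (s ^ d z w)\<^sup>2) = \<theta>2 * (s ^ d z y)\<^sup>2 + y2 * s ^ d z y + z2" for y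
    using neighbour_sum [of y z "d y z" "\<lambda>j. (s ^ j)\<^sup>2"] recurrence_s2 [of "d y z"] sym [of y z]
    unfolding \<theta>2_def y2_def z2_def by simp
  have "(\<Sum>y\<in>UNIV. m (d z y) * (\<theta>2 * (s ^ d z y)\<^sup>2 + y2 * s ^ d z y + z2))
      = (\<Sum>y\<in>UNIV. \<theta> * m (d z y) * (s ^ d z y)\<^sup>2)"
    using adjacency_self_adjoint [of "\<lambda>y. m (d z y)" "\<lambda>y. (s ^ d z y)\<^sup>2"]
    unfolding nb m_neighbour_sum sym [of _ z] .
  moreover have "(\<Sum>y\<in>UNIV. m (d z y) * (\<theta>2 * (s ^ d z y)\<^sup>2 + y2 * s ^ d z y + z2))
      = \<theta>2 * E2 + y2 * E1 + z2 * E0"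
    unfolding E0_def E1_def E2_def sum_distrib_left sum.distrib [symmetric]
    by (intro sum.cong) (simp_all add: algebra_simps)
  moreover have "(\<Sum>y\<in>UNIV. \<theta> * m (d z y) * (s ^ d z y)\<^sup>2) = \<theta> * E2"
    unfolding E2_def sum_distrib_left by (simp add: mult.assoc)
  ultimately have E2: "(\<theta> - \<theta>2) * E2 = y2 * E1" using E0 by (simp add: algebra_simps)
  have "(\<Sum>y\<in>UNIV. (m (d z y))\<^sup>2) = E1 + \<kappa> * E0"
    unfolding E0_def E1_def sum_distrib_left sum.distrib [symmetric]
    by (intro sum.cong) (simp_all add: m_def algebra_simps power2_eq_square)
  moreover have "(\<Sum>y\<in>UNIV. m (d z y) ^ 3) = E2 + 2 * \<kappa> * E1 + \<kappa>\<^sup>2 * E0"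
    unfolding E0_def E1_def E2_def sum_distrib_left sum.distrib [symmetric]
    by (intro sum.cong) (simp_all add: m_def algebra_simps power2_eq_square power3_eq_cube)
  ultimately show ?thesis using E0 E2 unfolding \<theta>2_def [symmetric] by (simp add: algebra_simps)
qed

text \<open>If \<alpha> < q - 1, then \<open>D\<close>, here a difference of recurrence coefficients
  and not the diameter, is negative; with C >= 0 and Q > 0 this forces
  \<open>y2 + 2 * \<kappa> * D \<le> 0\<close>. The product of this quantity with the negative
  number \<theta> - k has the sign of \<alpha> - (q - 1), a contradiction.\<close>

lemma krein_bound:
  assumes edge: "d y\<^sub>0 z\<^sub>0 = 1" and k: "k > 1" and b2: "b 2 \<ge> 0" and neg: "\<alpha> < 0"
  shows "q - 1 \<le> \<alpha>"
proof (rule ccontr)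
  assume "\<not> q - 1 \<le> \<alpha>"
  then have \<alpha>: "\<alpha> < q - 1" by simp
  define y2 where "y2 = (q + 1) * (1 + q\<^sup>2 - \<alpha> * (1 + q)) / q\<^sup>2"
  define z2 where "z2 = (q + 1) * \<alpha> / q\<^sup>2"
  define D where "D = \<theta> - (k * s\<^sup>2 - y2 - z2)"
  define Q where "Q = (\<Sum>z\<in>UNIV. \<Sum>y\<in>UNIV. (m (d z y))\<^sup>2)"
  define C where "C = (\<Sum>z\<in>UNIV. \<Sum>y\<in>UNIV. m (d z y) ^ 3)"
  have q0: "q \<noteq> 0" using q_less by auto
  have CQ: "D * C = (y2 + 2 * \<kappa> * D) * Q"
  proof -
    have "D * C = (\<Sum>z\<in>UNIV. D * (\<Sum>y\<in>UNIV. m (d z y) ^ 3))"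
      unfolding C_def by (rule sum_distrib_left)
    also have "\<dots> = (\<Sum>z\<in>UNIV. (y2 + 2 * \<kappa> * D) * (\<Sum>y\<in>UNIV. (m (d z y))\<^sup>2))"
      unfolding D_def y2_def z2_def sum_m_cube ..
    also have "\<dots> = (y2 + 2 * \<kappa> * D) * Q"
      unfolding Q_def by (rule sum_distrib_left [symmetric])
    finally show ?thesis .
  qed
  have "D * q\<^sup>2 = q * (q + 1) * (q - 1 - \<alpha>) + q * (k + 1) - (k - 1)"
    unfolding D_def \<theta>_def y2_def z2_def s_def using q0
    by (simp add: divide_simps) (simp add: algebra_simps eval_nat_numeral)
  \<comment> \<open>Grouped so that b_2 = k - (1 + q)(1 - \<alpha> q) appears; no group is
    positive.\<close>
  also have "\<dots> = q * ((1 + q) * (q - \<alpha> * (1 + q))) + q * (k - (1 + q) * (1 - \<alpha> * q)) + (q - k + 1)"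
    by (simp add: algebra_simps)
  also have "\<dots> < 0"
  proof -
    have "\<alpha> * (1 + q) > 0" using neg q_less by (intro mult_neg_neg) auto
    then have "(1 + q) * (q - \<alpha> * (1 + q)) > 0" using q_less by (intro mult_neg_neg) auto
    then have "q * ((1 + q) * (q - \<alpha> * (1 + q))) < 0" using q_less by (intro mult_neg_pos) auto
    moreover have "k - (1 + q) * (1 - \<alpha> * q) \<ge> 0" using b2 by (simp add: b_def algebra_simps)
    then have "q * (k - (1 + q) * (1 - \<alpha> * q)) \<le> 0" using q_less by (intro mult_nonpos_nonneg) auto
    ultimately show ?thesis using q_less k by linarith
  qed
  finally have D: "D < 0" using q0 by (simp add: mult_less_0_iff)
  have "m 0 > 0" using m_0_pos [OF edge] .
  then have "0 < (m (d y\<^sub>0 y\<^sub>0))\<^sup>2" by simp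
  also have "\<dots> \<le> (\<Sum>y\<in>UNIV. (m (d y\<^sub>0 y))\<^sup>2)" by (rule member_le_sum) auto
  also have "\<dots> \<le> Q" unfolding Q_def by (rule member_le_sum) (auto intro: sum_nonneg)
  finally have Q: "Q > 0" .
  have "C \<ge> 0" using sum_m_cube_nonneg [OF edge] unfolding C_def .
  then have "D * C \<le> 0" using D by (simp add: mult_nonpos_nonneg)
  then have "y2 + 2 * \<kappa> * D \<le> 0" unfolding CQ using Q by (simp add: mult_le_0_iff)
  then have "(y2 + 2 * \<kappa> * D) * (\<theta> - k) \<ge> 0" using theta_less by (simp add: mult_nonpos_nonpos)
  moreover have "\<kappa> * (\<theta> - k) = \<eta>" using theta_less by (simp add: \<kappa>_def)
  have "(y2 + 2 * \<kappa> * D) * (\<theta> - k) = y2 * (\<theta> - k) + 2 * (\<kappa> * (\<theta> - k)) * D"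
    by (simp add: algebra_simps)
  then have "(y2 + 2 * \<kappa> * D) * (\<theta> - k) = y2 * (\<theta> - k) + 2 * \<eta> * D"
    unfolding \<open>\<kappa> * (\<theta> - k) = \<eta>\<close> .
  moreover have "(y2 * (\<theta> - k) + 2 * \<eta> * D) * q ^ 4
      = q * ((q + 1)\<^sup>2 * ((1 - q) * ((q - 1 - \<alpha>) * (k - 1))))"
    unfolding D_def \<theta>_def \<eta>_def y2_def z2_def s_def using q0
    by (simp add: divide_simps) (simp add: algebra_simps eval_nat_numeral)
  ultimately have "q * ((q + 1)\<^sup>2 * ((1 - q) * ((q - 1 - \<alpha>) * (k - 1)))) \<ge> 0"
    by (metis mult_nonneg_nonneg zero_le_even_power even_numeral)
  moreover have "(q + 1)\<^sup>2 * ((1 - q) * ((q - 1 - \<alpha>) * (k - 1))) > 0"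
    using q_less \<alpha> k by (intro mult_pos_pos) auto
  ultimately show False using q_less by (simp add: zero_le_mult_iff)
qed

section \<open>Entries of the lowering and raising products\<close>

text \<open>Entries of the \<open>j\<close>-th power of the lowering matrix, divided by \<open>c 2 * \<dots> * c j\<close>.\<close>

definition low :: "'v \<Rightarrow> nat \<Rightarrow> 'v \<Rightarrow> 'v \<Rightarrow> real" where
  "low x j u y = of_bool (d x y = d x u + j \<and> d u y = j)"

text \<open>A vertex on a geodesic from \<open>u\<close> to \<open>y\<close> lies in the expected
  layer as soon as the layers of the end points differ by its full length. So all c_{j+1}
  intermediate vertices count.\<close>

lemma low_comp: "(\<Sum>v\<in>UNIV. low x 1 u v * low x j v y) = c (Suc j) * low x (Suc j) u y"
proof -
  have "(\<Sum>v\<in>UNIV. low x 1 u v * low x j v y)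
      = (\<Sum>v\<in>UNIV. of_bool (d u v = 1 \<and> d y v = j) * low x (Suc j) u y)"
  proof (rule sum.cong [OF refl])
    fix v
    show "low x 1 u v * low x j v y = of_bool (d u v = 1 \<and> d y v = j) * low x (Suc j) u y"
      using triangle [of u y v] triangle [of x y u] triangle [of x y v] triangle [of x v u] sym [of v y]
      unfolding low_def by (auto simp del: of_bool_conj)
  qed
  also have "\<dots> = real (card {v. d u v = 1 \<and> d y v = j}) * low x (Suc j) u y"
    by (simp flip: sum_distrib_right)
  also have "\<dots> = c (Suc j) * low x (Suc j) u y"
    using card_c [of u y j] by (simp add: low_def)
  finally show ?thesis .
qed

lemma sum_low2:
  assumes "d x y = 3" shows "(\<Sum>u\<in>UNIV. low x 2 u y * of_bool (d x u = 1)) = c 3"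
proof -
  have "(\<Sum>u\<in>UNIV. low x 2 u y * of_bool (d x u = 1)) = (\<Sum>u\<in>UNIV. of_bool (d x u = 1 \<and> d y u = 2))"
    using assms sym [of y] by (intro sum.cong) (auto simp: low_def)
  then show ?thesis using card_c [of x y 2] assms by simp
qed

definition RLL where "RLL x z y = (\<Sum>u\<in>UNIV. low x 1 u z * (\<Sum>v\<in>UNIV. low x 1 u v * low x 1 v y))"
definition LRL where "LRL x z y = (\<Sum>u\<in>UNIV. low x 1 z u * (\<Sum>v\<in>UNIV. low x 1 v u * low x 1 v y))"
definition LLR where "LLR x z y = (\<Sum>u\<in>UNIV. low x 1 z u * (\<Sum>v\<in>UNIV. low x 1 u v * low x 1 y v))"

lemma RLL_eq: "RLL x z y = c 2 * (\<Sum>u\<in>UNIV. low x 1 u z * low x 2 u y)"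
  using low_comp [of x _ 1 y] by (simp add: RLL_def numeral_2_eq_2 sum_distrib_left algebra_simps)

text \<open>The (z,v)-entry of L R.\<close>

definition up_down where "up_down x z v = (\<Sum>u\<in>UNIV. low x 1 z u * low x 1 v u)"

lemma LRL_eq: "LRL x z y = (\<Sum>v\<in>UNIV. low x 1 v y * up_down x z v)"
proof -
  have "LRL x z y = (\<Sum>u\<in>UNIV. \<Sum>v\<in>UNIV. low x 1 v y * (low x 1 z u * low x 1 v u))"
    unfolding LRL_def sum_distrib_left by (simp only: ac_simps)
  also have "\<dots> = (\<Sum>v\<in>UNIV. \<Sum>u\<in>UNIV. low x 1 v y * (low x 1 z u * low x 1 v u))"
    by (rule sum.swap)
  finally show ?thesis by (simp add: up_down_def sum_distrib_left)
qed

text \<open>The (z,y)-entry of L^j R, normalised as for \<open>low\<close>; for j = 1 it is the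
  entry of L R again.\<close>

definition far where "far x j z y = (\<Sum>v\<in>UNIV. low x j z v * low x 1 y v)"

lemma far_step: "(\<Sum>w\<in>UNIV. low x 1 z w * far x j w y) = c (Suc j) * far x (Suc j) z y"
proof -
  have "(\<Sum>w\<in>UNIV. low x 1 z w * far x j w y)
      = (\<Sum>w\<in>UNIV. \<Sum>v\<in>UNIV. low x 1 z w * low x j w v * low x 1 y v)"
    by (simp add: far_def sum_distrib_left mult.assoc)
  also have "\<dots> = (\<Sum>v\<in>UNIV. \<Sum>w\<in>UNIV. low x 1 z w * low x j w v * low x 1 y v)"
    by (rule sum.swap)
  also have "\<dots> = (\<Sum>v\<in>UNIV. c (Suc j) * low x (Suc j) z v * low x 1 y v)"
    by (simp only: sum_distrib_right [symmetric] low_comp)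
  finally show ?thesis by (simp add: far_def sum_distrib_left mult.assoc)
qed

lemma LLR_eq: "LLR x z y = c 2 * far x 2 z y"
proof -
  have "LLR x z y = (\<Sum>w\<in>UNIV. low x 1 z w * far x 1 w y)"
    by (simp add: LLR_def far_def)
  then show ?thesis using far_step [of x z 1 y] by (simp add: numeral_2_eq_2)
qed

lemma far_eq_card:
  assumes "d x y = d x z + (j - 1)" "j \<ge> 1"
  shows "far x j z y = real (card {v. d y v = 1 \<and> d z v = j \<and> d x v = d x y + 1})"
proof -
  have "far x j z y = (\<Sum>v\<in>UNIV. of_bool (d y v = 1 \<and> d z v = j \<and> d x v = d x y + 1))"
    unfolding far_def low_def using assms by (intro sum.cong) auto
  then show ?thesis by simp
qed

text \<open>Two distinct neighbours of \<open>x\<close> have c_2 common neighbours, one of them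
  \<open>x\<close>; the others lie in the second layer because there are no triangles. So on the
  first layer L R is a combination of the identity and the all-ones matrix.\<close>

lemma up_down_eq:
  assumes z: "d x z = 1" and v: "d x v = 1"
  shows "up_down x z v = (c 2 - 1) + (k - c 2) * of_bool (v = z)"
proof (cases "v = z")
  case True
  have "up_down x z v = (\<Sum>u\<in>UNIV. of_bool (d z u = 1 \<and> d x u = Suc 1))"
    unfolding up_down_def low_def using True z by (intro sum.cong) auto
  then have "up_down x z v = b 1"
    using card_b [of z x 1] z sym [of x z] by simp
  then show ?thesis using True by (simp add: b_def)
next
  case False
  then have zv: "d z v = 2" using dist_common_neighbour [of x v z] z v by simp
  have *: "d x u = Suc 1 \<longleftrightarrow> u \<noteq> x" if "d z u = 1" for u
  proof -
    have "d x u \<noteq> 1" "d x u \<le> 2" using that z triangle_free [of x z u] triangle [of x u z] by auto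
    moreover have "d x u \<noteq> 0 \<longleftrightarrow> u \<noteq> x" by auto
    ultimately show ?thesis by linarith
  qed
  have "up_down x z v = (\<Sum>u\<in>UNIV. of_bool (u \<in> {u. d z u = 1 \<and> d v u = 1} - {x}))"
    unfolding up_down_def low_def using z v * by (intro sum.cong) (auto simp: sym [of v])
  also have "\<dots> = real (card ({u. d z u = 1 \<and> d v u = 1} - {x}))" by (simp add: set_diff_eq)
  also have "\<dots> = real (card {u. d z u = 1 \<and> d v u = 1}) - 1"
    using card.remove [of "{u. d z u = 1 \<and> d v u = 1}" x] z v sym [of x] by simp
  finally show ?thesis using card_c [of z v 1] zv False by (simp add: numeral_2_eq_2)
qed

section \<open>Triple intersection numbers from the absence of parallelograms\<close>

lemma cross_sum_3:
  fixes f :: "nat \<Rightarrow> real"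
  assumes yz: "d y z = 3" and w: "d y w = 1" "d z w = 2"
  shows "(\<Sum>a | d z a = 1 \<and> d y a = 2. f (d w a)) = c 2 * f 1 + (c 3 - c 2) * f 3"
proof -
  have "{a. d z a = 1 \<and> d y a = 2 \<and> d w a = 2} = {}"
    using no_parallelogram_3 [OF yz w] by auto
  then show ?thesis using cross_sum [of y z 1 w f] yz w by (simp add: eval_nat_numeral)
qed

lemma cross_sum_4:
  fixes f :: "nat \<Rightarrow> real"
  assumes yz: "d y z = 4" and w: "d y w = 1" "d z w = 3"
  shows "(\<Sum>a | d z a = 1 \<and> d y a = 3. f (d w a)) = c 3 * f 2 + (c 4 - c 3) * f 4"
proof -
  have "{a. d z a = 1 \<and> d y a = 3 \<and> d w a = 3} = {}"
    using no_parallelogram_4 [OF yz w] by auto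
  then show ?thesis using cross_sum [of y z 2 w f] yz w by (simp add: eval_nat_numeral)
qed

text \<open>If \<open>z\<close> and \<open>y\<close> are adjacent, every neighbour of
  \<open>y\<close> in the third layer counts. At distance 2 such a vertex would complete a
  parallelogram with \<open>x\<close>, \<open>z\<close>, \<open>y\<close>. At distance 3 the vertex
  \<open>x\<close> is a neighbour of \<open>z\<close> on a geodesic to \<open>y\<close>, and
  \<open>cross_sum_3\<close> applies to that pair.\<close>

lemma far_2:
  assumes x: "d x z = 1" "d x y = 2"
  shows "far x 2 z y = b 2 * of_bool (d z y = 1) + (c 3 - c 2) * of_bool (d z y = 3)"
proof -
  have F: "far x 2 z y = real (card {v. d y v = 1 \<and> d z v = 2 \<and> d x v = 3})"
    using far_eq_card [of x y z 2] x by simp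
  have "d z y = 1 \<or> d z y = 2 \<or> d z y = 3"
    using dist_neighbour [of x z y] x sym [of x y] sym [of y z] by auto
  then show ?thesis
  proof (elim disjE)
    assume zy: "d z y = 1"
    have "d z v = 2" if "d y v = 1" "d x v = 3" for v
      using triangle [of z v y] triangle [of x v z] zy x that by simp
    then have "{v. d y v = 1 \<and> d z v = 2 \<and> d x v = 3} = {v. d y v = 1 \<and> d x v = Suc 2}" by auto
    then show ?thesis using F card_b [of y x 2] x sym [of x y] zy by simp
  next
    assume zy: "d z y = 2"
    have "d z v \<noteq> 2" if "d y v = 1" "d x v = 3" for v
      using no_parallelogram_3 [of x v z y] x zy that sym [of y v] sym [of z v] by auto
    then have "{v. d y v = 1 \<and> d z v = 2 \<and> d x v = 3} = {}" by auto
    then show ?thesis using F zy by simp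
  next
    assume zy: "d z y = 3"
    have "far x 2 z y = (\<Sum>a | d y a = 1 \<and> d z a = 2. of_bool (d x a = 3))"
      unfolding F by (simp add: Int_def conj_assoc)
    also have "\<dots> = c 3 - c 2"
      using cross_sum_3 [of z y x "\<lambda>j. of_bool (j = 3)"] zy x sym [of x] by simp
    finally show ?thesis using zy by simp
  qed
qed

lemma far_3:
  assumes x: "d x z = 1" "d x y = 3"
  shows "far x 3 z y = b 3 * of_bool (d z y = 2) + (c 4 - c 3) * of_bool (d z y = 4)"
proof -
  have F: "far x 3 z y = real (card {v. d y v = 1 \<and> d z v = 3 \<and> d x v = 4})"
    using far_eq_card [of x y z 3] x by simp
  have "d z y = 2 \<or> d z y = 3 \<or> d z y = 4"
    using dist_neighbour [of x z y] x sym [of x y] sym [of y z] by auto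
  then show ?thesis
  proof (elim disjE)
    assume zy: "d z y = 2"
    have "d z v = 3" if "d y v = 1" "d x v = 4" for v
      using triangle [of z v y] triangle [of x v z] zy x that by simp
    then have "{v. d y v = 1 \<and> d z v = 3 \<and> d x v = 4} = {v. d y v = 1 \<and> d x v = Suc 3}" by auto
    then show ?thesis using F card_b [of y x 3] x sym [of x y] zy by simp
  next
    assume zy: "d z y = 3"
    have "d z v \<noteq> 3" if "d y v = 1" "d x v = 4" for v
      using no_parallelogram_4 [of x v z y] x zy that sym [of y v] sym [of z v] by auto
    then have "{v. d y v = 1 \<and> d z v = 3 \<and> d x v = 4} = {}" by auto
    then show ?thesis using F zy by simp
  next
    assume zy: "d z y = 4"
    have "far x 3 z y = (\<Sum>a | d y a = 1 \<and> d z a = 3. of_bool (d x a = 4))"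
      unfolding F by (simp add: Int_def conj_assoc)
    also have "\<dots> = c 4 - c 3"
      using cross_sum_4 [of z y x "\<lambda>j. of_bool (j = 4)"] zy x sym [of x] by simp
    finally show ?thesis using zy by simp
  qed
qed

lemma LRL_endpoint_2:
  assumes x: "d x z = 1" "d x y = 2"
  shows "LRL x z y = c 2 * (c 2 - 1) + (k - c 2) * of_bool (d z y = 1)"
proof -
  have *: "low x 1 v y = of_bool (d x v = 1 \<and> d y v = 1)" for v
    using x by (auto simp: low_def sym [of v y])
  have "LRL x z y = (\<Sum>v\<in>UNIV. of_bool (d x v = 1 \<and> d y v = 1) * (c 2 - 1)
      + of_bool (v = z) * ((k - c 2) * of_bool (d z y = 1)))"
    unfolding LRL_eq *
  proof (rule sum.cong [OF refl])
    fix v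
    show "of_bool (d x v = 1 \<and> d y v = 1) * up_down x z v
      = of_bool (d x v = 1 \<and> d y v = 1) * (c 2 - 1) + of_bool (v = z) * ((k - c 2) * of_bool (d z y = 1))"
      using up_down_eq [OF x(1), of v] x sym [of z y]
      by (cases "v = z"; cases "d x v = 1") (auto simp: algebra_simps)
  qed
  also have "\<dots> = real (card {v. d x v = 1 \<and> d y v = 1}) * (c 2 - 1) + (k - c 2) * of_bool (d z y = 1)"
    by (simp only: sum.distrib sum_distrib_right [symmetric]) simp
  finally show ?thesis using card_c [of x y 1] x by (simp add: numeral_2_eq_2)
qed

lemma RLL_endpoint_2:
  assumes x: "d x z = 1" "d x y = 2"
  shows "RLL x z y = c 2"
proof -
  have "(\<Sum>u\<in>UNIV. low x 1 u z * low x 2 u y) = (\<Sum>u\<in>UNIV. of_bool (u = x))"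
    using x sym [of _ x] by (intro sum.cong) (auto simp: low_def)
  then show ?thesis by (simp add: RLL_eq)
qed

section \<open>The third-layer condition multiplied by L from the left\<close>

text \<open>Regrouped as (L R) L^2, the product needs L R only on the first layer, where
  \<open>up_down_eq\<close> gives it.\<close>

lemma compose_RLL:
  assumes x: "d x z = 1" "d x y = 3"
  shows "(\<Sum>w\<in>UNIV. low x 1 z w * RLL x w y)
    = c 2 * ((c 2 - 1) * c 3 + (k - c 2) * of_bool (d z y = 2))"
proof -
  have "(\<Sum>w\<in>UNIV. low x 1 z w * RLL x w y)
      = (\<Sum>w\<in>UNIV. \<Sum>u\<in>UNIV. c 2 * (low x 2 u y * (low x 1 z w * low x 1 u w)))"
    unfolding RLL_eq sum_distrib_left by (simp only: ac_simps)
  also have "\<dots> = (\<Sum>u\<in>UNIV. \<Sum>w\<in>UNIV. c 2 * (low x 2 u y * (low x 1 z w * low x 1 u w)))"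
    by (rule sum.swap)
  also have "\<dots> = c 2 * (\<Sum>u\<in>UNIV. low x 2 u y * up_down x z u)"
    by (simp only: up_down_def sum_distrib_left)
  also have "(\<Sum>u\<in>UNIV. low x 2 u y * up_down x z u)
      = (\<Sum>u\<in>UNIV. low x 2 u y * of_bool (d x u = 1) * (c 2 - 1) + of_bool (u = z) * ((k - c 2) * of_bool (d z y = 2)))"
  proof (rule sum.cong [OF refl])
    fix u
    show "low x 2 u y * up_down x z u
      = low x 2 u y * of_bool (d x u = 1) * (c 2 - 1) + of_bool (u = z) * ((k - c 2) * of_bool (d z y = 2))"
      using up_down_eq [OF x(1), of u] x
      by (cases "u = z"; cases "d x u = 1") (auto simp: low_def algebra_simps)
  qed
  also have "\<dots> = c 3 * (c 2 - 1) + (k - c 2) * of_bool (d z y = 2)"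
    by (simp only: sum.distrib sum_distrib_right [symmetric] sum_low2 [OF x(2)]) simp
  finally show ?thesis by simp
qed

lemma compose_LLR:
  assumes x: "d x z = 1" "d x y = 3"
  shows "(\<Sum>w\<in>UNIV. low x 1 z w * LLR x w y)
    = c 2 * (c 3 * (b 3 * of_bool (d z y = 2) + (c 4 - c 3) * of_bool (d z y = 4)))"
proof -
  have "(\<Sum>w\<in>UNIV. low x 1 z w * LLR x w y) = c 2 * (\<Sum>w\<in>UNIV. low x 1 z w * far x 2 w y)"
    unfolding LLR_eq sum_distrib_left by (simp only: ac_simps)
  also have "\<dots> = c 2 * (c 3 * far x 3 z y)" using far_step [of x z 2 y] by simp
  finally show ?thesis using far_3 [OF x] by simp
qed

text \<open>Regrouped as (L^2 R) L, so that \<open>far_2\<close> gives the left factor.\<close>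

lemma compose_LRL:
  assumes x: "d x z = 1" "d x y = 3"
  shows "(\<Sum>w\<in>UNIV. low x 1 z w * LRL x w y)
    = c 2 * (\<Sum>v | d y v = 1 \<and> d x v = 2. b 2 * of_bool (d z v = 1) + (c 3 - c 2) * of_bool (d z v = 3))"
proof -
  have *: "(\<Sum>w\<in>UNIV. low x 1 z w * up_down x w v) = LLR x z v" for v
  proof -
    have "(\<Sum>w\<in>UNIV. low x 1 z w * up_down x w v) = (\<Sum>w\<in>UNIV. low x 1 z w * far x 1 w v)"
      by (simp add: up_down_def far_def)
    then show ?thesis by (simp add: LLR_def far_def)
  qed
  have "(\<Sum>w\<in>UNIV. low x 1 z w * LRL x w y)
      = (\<Sum>w\<in>UNIV. \<Sum>v\<in>UNIV. low x 1 v y * (low x 1 z w * up_down x w v))"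
    unfolding LRL_eq sum_distrib_left by (simp only: ac_simps)
  also have "\<dots> = (\<Sum>v\<in>UNIV. \<Sum>w\<in>UNIV. low x 1 v y * (low x 1 z w * up_down x w v))"
    by (rule sum.swap)
  also have "\<dots> = (\<Sum>v\<in>UNIV. low x 1 v y * LLR x z v)"
    by (simp only: * flip: sum_distrib_left)
  also have "\<dots> = (\<Sum>v\<in>UNIV. of_bool (v \<in> {v. d y v = 1 \<and> d x v = 2}) *
      (c 2 * (b 2 * of_bool (d z v = 1) + (c 3 - c 2) * of_bool (d z v = 3))))"
  proof (rule sum.cong [OF refl])
    fix v
    show "low x 1 v y * LLR x z v = of_bool (v \<in> {v. d y v = 1 \<and> d x v = 2}) *
      (c 2 * (b 2 * of_bool (d z v = 1) + (c 3 - c 2) * of_bool (d z v = 3)))"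
      using far_2 [OF x(1), of v] x sym [of v y] by (cases "d x v = 2") (auto simp: low_def LLR_eq)
  qed
  also have "\<dots> = (\<Sum>v | d y v = 1 \<and> d x v = 2.
      c 2 * (b 2 * of_bool (d z v = 1) + (c 3 - c 2) * of_bool (d z v = 3)))"
    by (simp add: Int_def del: mem_Collect_eq)
  finally show ?thesis by (simp only: sum_distrib_left)
qed

lemma compose_low:
  assumes x: "d x z = 1" "d x y = 3"
  shows "(\<Sum>w\<in>UNIV. low x 1 z w * low x 1 w y) = c 2 * of_bool (d z y = 2)"
  using low_comp [of x z 1 y] x by (simp add: low_def numeral_2_eq_2)

lemma compose_LRL_2:
  assumes x: "d x z = 1" "d x y = 3" and zy: "d z y = 2"
  shows "(\<Sum>w\<in>UNIV. low x 1 z w * LRL x w y) = c 2 * (c 2 * b 2 + (c 3 - c 2)\<^sup>2)"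
  unfolding compose_LRL [OF x]
  using cross_sum_3 [of x y z "\<lambda>j. b 2 * of_bool (j = 1) + (c 3 - c 2) * of_bool (j = 3)"] x zy sym [of y z]
  by (simp add: power2_eq_square)

text \<open>Neither of \<open>x\<close> and \<open>z\<close> is on a geodesic from the other to
  \<open>y\<close>, so \<open>cross_sum_3\<close> does not apply. Instead \<open>balanced_3\<close>
  for the pair \<open>x\<close>, \<open>y\<close> is evaluated at \<open>z\<close>: the neighbours
  of \<open>x\<close> in its sum are all at distance 2 from \<open>z\<close>, which leaves this
  cardinality as the only unknown.\<close>

lemma card_3_3:
  assumes x: "d x z = 1" "d x y = 3" and zy: "d z y = 3"
  shows "real (card {v. d y v = 1 \<and> d x v = 2 \<and> d z v = 3}) = \<tau> * (1 + q)"
proof -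
  let ?n = "real (card {v. d y v = 1 \<and> d x v = 2 \<and> d z v = 3})"
  have yx: "d y x = 3" "d z x = 1" "d y z = 3" using x zy sym by auto
  have near: "d z v = 2 \<or> d z v = 3" if "d y v = 1" "d x v = 2" for v
  proof -
    have "d z v \<ge> 2" "d z v \<le> 3"
      using triangle [of z y v] triangle [of z v x] sym [of v y] sym [of v x]
        triangle [of z v y] triangle [of z x v] zy x yx that by simp_all
    then show ?thesis by linarith
  qed
  have "(\<Sum>v | d y v = 1 \<and> d x v = 2. s ^ d v z)
      = (\<Sum>v | d y v = 1 \<and> d x v = 2. s\<^sup>2 + of_bool (d z v = 3) * (s ^ 3 - s\<^sup>2))"
  proof (rule sum.cong [OF refl])
    fix v assume "v \<in> {v. d y v = 1 \<and> d x v = 2}"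
    then show "s ^ d v z = s\<^sup>2 + of_bool (d z v = 3) * (s ^ 3 - s\<^sup>2)"
      using near [of v] sym [of v z] by auto
  qed
  also have "\<dots> = c 3 * s\<^sup>2 + ?n * (s ^ 3 - s\<^sup>2)"
    using card_c [of y x 2] yx by (simp add: sum.distrib sum_constant_fibre conj_assoc del: sum_of_bool_mult_eq)
  finally have 1: "(\<Sum>v | d y v = 1 \<and> d x v = 2. s ^ d v z) = c 3 * s\<^sup>2 + ?n * (s ^ 3 - s\<^sup>2)" .
  have "(\<Sum>v | d x v = 1 \<and> d y v = 2. s ^ d v z) = (\<Sum>v | d x v = 1 \<and> d y v = 2. s\<^sup>2)"
  proof (rule sum.cong [OF refl])
    fix v assume v: "v \<in> {v. d x v = 1 \<and> d y v = 2}"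
    then have "v \<noteq> z" using yx by auto
    then have "d v z = 2" using dist_common_neighbour [of x z v] v x by simp
    then show "s ^ d v z = s\<^sup>2" by simp
  qed
  also have "\<dots> = c 3 * s\<^sup>2" using card_c [of x y 2] x by simp
  finally have 2: "(\<Sum>v | d x v = 1 \<and> d y v = 2. s ^ d v z) = c 3 * s\<^sup>2" .
  have "?n * (s\<^sup>2 - s ^ 3) = \<tau> * (s - s ^ 3)"
    using balanced_3 [OF x(2), of z] x yx unfolding 1 2 by (simp add: algebra_simps)
  also have "s - s ^ 3 = (1 + q) * (s\<^sup>2 - s ^ 3)"
  proof -
    have "q * s\<^sup>2 = (q * s) * s" "q * s ^ 3 = (q * s) * s\<^sup>2" by (simp_all add: eval_nat_numeral)
    then show ?thesis unfolding q_s by (simp add: algebra_simps)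
  qed
  finally show ?thesis using s_bounds by (simp add: eval_nat_numeral mult.assoc [symmetric])
qed

lemma compose_LRL_3:
  assumes x: "d x z = 1" "d x y = 3" and zy: "d z y = 3"
  shows "(\<Sum>w\<in>UNIV. low x 1 z w * LRL x w y) = c 2 * ((c 3 - c 2) * (\<tau> * (1 + q)))"
proof -
  have "d z v \<noteq> 1" if "d y v = 1" for v
    using triangle [of z y v] sym [of v y] that zy by simp
  then have "(\<Sum>v | d y v = 1 \<and> d x v = 2. b 2 * of_bool (d z v = 1) + (c 3 - c 2) * of_bool (d z v = 3))
      = (\<Sum>v | d y v = 1 \<and> d x v = 2. of_bool (d z v = 3) * (c 3 - c 2))"
    by (intro sum.cong) auto
  then show ?thesis unfolding compose_LRL [OF x]
    using card_3_3 [OF x zy] by (simp add: sum_constant_fibre conj_assoc del: sum_of_bool_mult_eq)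
qed

lemma compose_LRL_4:
  assumes x: "d x z = 1" "d x y = 3" and zy: "d z y = 4"
  shows "(\<Sum>w\<in>UNIV. low x 1 z w * LRL x w y) = c 2 * ((c 3 - c 2) * c 3)"
proof -
  have "d z v = 3" if "d y v = 1" "d x v = 2" for v
    using triangle [of z y v] triangle [of z v x] sym [of v y] sym [of v x] sym [of z x] that zy x by simp
  then have "(\<Sum>v | d y v = 1 \<and> d x v = 2. b 2 * of_bool (d z v = 1) + (c 3 - c 2) * of_bool (d z v = 3))
      = (\<Sum>v | d y v = 1 \<and> d x v = 2. c 3 - c 2)"
    by (intro sum.cong) auto
  then show ?thesis unfolding compose_LRL [OF x]
    using card_c [of y x 2] x sym [of x y] by simp
qed

section \<open>Entries for adjacent vertices in layers two and three\<close>

lemma RLL_adjacent: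
  assumes x: "d x z = 2" "d x y = 3" and zy: "d z y = 1"
  shows "RLL x z y = (c 2)\<^sup>2"
proof -
  have *: "d u y = 2" if "d x u = 1" "d u z = 1" for u
    using triangle [of u y z] triangle [of x y u] that x zy by simp
  have "(\<Sum>u\<in>UNIV. low x 1 u z * low x 2 u y) = (\<Sum>u\<in>UNIV. of_bool (d x u = 1 \<and> d z u = 1))"
    using x * sym [of z] by (intro sum.cong) (auto simp: low_def)
  then show ?thesis using card_c [of x z 1] x by (simp add: RLL_eq numeral_2_eq_2 power2_eq_square)
qed

lemma LLR_adjacent:
  assumes x: "d x z = 2" "d x y = 3" and zy: "d z y = 1"
  shows "LLR x z y = c 2 * b 3"
proof -
  have "d z v = 2" if "d y v = 1" "d x v = 4" for v
    using triangle [of z v y] triangle [of x v z] that x zy by simp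
  then have "{v. d y v = 1 \<and> d z v = 2 \<and> d x v = 4} = {v. d y v = 1 \<and> d x v = Suc 3}" by auto
  then have "far x 2 z y = b 3"
    using far_eq_card [of x y z 2] card_b [of y x 3] x sym [of x y] by simp
  then show ?thesis by (simp add: LLR_eq)
qed

text \<open>The bound counts the walks that go from \<open>y\<close> down to \<open>z\<close>, up to
  the third layer and back to \<open>z\<close>.\<close>

lemma LRL_adjacent:
  assumes x: "d x z = 2" "d x y = 3" and zy: "d z y = 1"
  shows "LRL x z y \<ge> b 2"
proof -
  have "up_down x z z = (\<Sum>u\<in>UNIV. of_bool (d z u = 1 \<and> d x u = Suc 2))"
    unfolding up_down_def low_def using x by (intro sum.cong) auto
  then have "up_down x z z = b 2" using card_b [of z x 2] x sym [of x z] by simp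
  then have "b 2 = low x 1 z y * up_down x z z" using x zy by (simp add: low_def)
  also have "\<dots> \<le> LRL x z y"
    unfolding LRL_eq by (rule member_le_sum) (auto simp: up_down_def low_def intro!: sum_nonneg)
  finally show ?thesis .
qed

section \<open>The contradiction\<close>

text \<open>As c_2 is a positive integer and 1 + q < 0, \<alpha> < -1 follows, and with it the later
  sign conditions. The last two say that a_3 and a_2 are positive.\<close>

lemma parameters:
  assumes "d x y = 3"
  shows "c 2 \<ge> 1" "c 2 \<noteq> 1 \<Longrightarrow> c 2 \<ge> 2" "\<alpha> < - 1" "k > 1" "b 2 > 0" "b 3 \<ge> 0"
    "q - 1 \<le> \<alpha>" "c 2 < c 3" "c 3 < k - b 3" "c 2 < k - b 2"
proof -
  obtain w where w: "d x w = 1" "d w y = 2" using geodesic [of x y 2] assms by auto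
  have "c 2 > 0" using c_pos [of w y 1] w by (simp add: numeral_2_eq_2)
  moreover have card: "c 2 = real (card {u. d w u = 1 \<and> d y u = 1})"
    using card_c [of w y 1] w by (simp add: numeral_2_eq_2)
  ultimately show c2: "c 2 \<ge> 1" and "c 2 \<noteq> 1 \<Longrightarrow> c 2 \<ge> 2" by simp_all
  have "(1 + q) * (1 + \<alpha>) > 0" using c2 by (simp add: c_simps)
  then show \<alpha>: "\<alpha> < - 1" using q_less by (simp add: zero_less_mult_iff)
  show k: "k > 1" using b_pos [of w y 1] w by (simp add: b_def)
  show b2: "b 2 > 0" using b_pos [of x y 2] assms by simp
  show "b 3 \<ge> 0" using card_b [of x y 3] assms by (metis of_nat_0_le_iff)
  show "q - 1 \<le> \<alpha>" using krein_bound [OF w(1) k] b2 \<alpha> by simp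
  have q2: "1 + q + q\<^sup>2 > 0"
  proof -
    have "q * (1 + q) > 0" using q_less by (intro mult_neg_neg) auto
    then show ?thesis by (simp add: algebra_simps power2_eq_square)
  qed
  have "c 3 - c 2 = q * (q + \<alpha> * (1 + q)\<^sup>2)"
    by (simp add: c_simps algebra_simps power2_eq_square)
  moreover have "\<alpha> * (1 + q)\<^sup>2 < 0" using \<alpha> q_less by (intro mult_neg_pos) auto
  then have "q * (q + \<alpha> * (1 + q)\<^sup>2) > 0" using q_less by (intro mult_neg_neg) auto
  ultimately show "c 2 < c 3" by simp
  have "k - b 3 - c 3 = - ((1 + q + q\<^sup>2) * (\<alpha> * (1 + q)\<^sup>2))"
    by (simp add: c_simps b_def algebra_simps power2_eq_square)
  moreover have "(1 + q + q\<^sup>2) * (\<alpha> * (1 + q)\<^sup>2) < 0"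
    using q2 \<alpha> q_less by (intro mult_pos_neg mult_neg_pos) auto
  ultimately show "c 3 < k - b 3" by simp
  have "k - b 2 - c 2 = - (\<alpha> * (1 + q)\<^sup>2)"
    by (simp add: c_simps b_def algebra_simps power2_eq_square)
  then show "c 2 < k - b 2" using \<open>\<alpha> * (1 + q)\<^sup>2 < 0\<close> by simp
qed

lemma same_distance_neighbour:
  assumes "d x y = h" "c h < k - b h" "h > 0"
  shows "\<exists>z. d x z = 1 \<and> d z y = h"
proof (rule ccontr)
  assume "\<not> ?thesis"
  then have "(\<Sum>w | d x w = 1. of_bool (d y w = h) :: real) = 0"
    using sym [of y] by (intro sum.neutral) auto
  then show False
    using neighbour_sum [OF assms(1), of "\<lambda>j. of_bool (j = h)"] assms
    by (cases h) (simp_all del: sum_of_bool_eq)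
qed

lemma far_neighbour:
  assumes "d x y = h" "b h > 0"
  shows "\<exists>z. d x z = 1 \<and> d z y = Suc h"
proof -
  have "{w. d x w = 1 \<and> d y w = Suc h} \<noteq> {}"
    using card_b [OF assms(1)] assms(2) by (metis card.empty less_irrefl of_nat_0)
  then show ?thesis using sym by auto
qed

text \<open>For \<open>z\<close> not adjacent to \<open>y\<close> the right-hand side vanishes and
  \<open>f\<close> drops out. At distance 2 the entry of L^2 R vanishes as well, which isolates
  \<open>em\<close>; distance 3 then yields \<open>ep\<close>.\<close>

lemma uniform_2:
  fixes em ep f :: complex
  assumes y3: "d x y3 = 3"
    and eq: "\<And>z y. d x y = 2 \<Longrightarrow>
      em * of_real (RLL x z y) + of_real (LRL x z y) + ep * of_real (LLR x z y) = f * of_real (low x 1 z y)"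
  shows "ep = 0" "em = 1 - of_real (c 2)"
proof -
  note par = parameters [OF y3]
  obtain y where y: "d x y = 2" using geodesic [of y3 x 2] y3 sym by (metis numeral_2_eq_2 numeral_3_eq_3)
  have eq': "em * of_real (c 2) + of_real (c 2 * (c 2 - 1)) + ep * of_real (c 2 * far x 2 z y) = 0"
    if "d x z = 1" "d z y \<noteq> 1" for z
    using eq [OF y, of z] that y RLL_endpoint_2 [of x z y] LRL_endpoint_2 [of x z y]
    by (simp add: LLR_eq low_def)
  obtain z2 where z2: "d x z2 = 1" "d z2 y = 2"
    using same_distance_neighbour [OF y] par by auto
  have "of_real (c 2) * (em - (1 - of_real (c 2))) = 0"
    using eq' [OF z2(1)] far_2 [OF z2(1) y] z2(2) by (simp add: algebra_simps)
  then show m: "em = 1 - of_real (c 2)" using par(1) by simp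
  obtain z3 where z3: "d x z3 = 1" "d z3 y = 3"
    using far_neighbour [OF y] par by auto
  have "ep * (of_real (c 2) * of_real (c 3 - c 2)) = 0"
    using eq' [OF z3(1)] far_2 [OF z3(1) y] z3(2) unfolding m by (simp add: algebra_simps)
  then show "ep = 0" using par by simp
qed

text \<open>In the composed equation \<open>f\<close> occurs only when \<open>z\<close> and
  \<open>y3\<close> are at distance 2, and \<open>g\<close> only at distances 2 and 4. So distance 3
  determines \<open>e\<close>, distance 4 the sign of \<open>g\<close>, and distance 2 expresses
  \<open>f\<close>.\<close>

lemma uniform_3:
  fixes e g f :: real
  assumes y3: "d x y3 = 3" and c2: "c 2 \<noteq> 1"
    and eq: "\<And>z y. d x y = 3 \<Longrightarrow>
      e * RLL x z y + LRL x z y + g * LLR x z y = f * low x 1 z y"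
  shows False
proof -
  note par = parameters [OF y3]
  have c2': "c 2 \<noteq> 0" "c 3 \<noteq> 0" using par by auto
  have comp: "e * (\<Sum>w\<in>UNIV. low x 1 z w * RLL x w y3) + (\<Sum>w\<in>UNIV. low x 1 z w * LRL x w y3)
      + g * (\<Sum>w\<in>UNIV. low x 1 z w * LLR x w y3) = f * (\<Sum>w\<in>UNIV. low x 1 z w * low x 1 w y3)" for z
  proof -
    have "(\<Sum>w\<in>UNIV. low x 1 z w * (e * RLL x w y3 + LRL x w y3 + g * LLR x w y3))
        = (\<Sum>w\<in>UNIV. low x 1 z w * (f * low x 1 w y3))"
      by (simp only: eq [OF y3])
    then show ?thesis
      unfolding distrib_left sum.distrib sum_distrib_left mult.left_commute [of "low x 1 z _"] .
  qed
  obtain z2 where z2: "d x z2 = 1" "d z2 y3 = 2" using geodesic [of x y3 2] y3 by auto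
  obtain z3 where z3: "d x z3 = 1" "d z3 y3 = 3"
    using same_distance_neighbour [OF y3] par by auto
  have "c 2 * (e * ((c 2 - 1) * c 3 + (k - c 2)) + (c 2 * b 2 + (c 3 - c 2)\<^sup>2) + g * (c 3 * b 3)) = c 2 * f"
    using comp [of z2] z2 unfolding compose_RLL [OF z2(1) y3] compose_LLR [OF z2(1) y3]
      compose_LRL_2 [OF z2(1) y3 z2(2)] compose_low [OF z2(1) y3] by (simp add: algebra_simps)
  then have f: "f = e * ((c 2 - 1) * c 3 + (k - c 2)) + (c 2 * b 2 + (c 3 - c 2)\<^sup>2) + g * (c 3 * b 3)"
    using c2' by simp
  have "c 2 * (e * ((c 2 - 1) * c 3) + (c 3 - c 2) * (\<tau> * (1 + q))) = 0"
    using comp [of z3] z3 unfolding compose_RLL [OF z3(1) y3] compose_LLR [OF z3(1) y3]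
      compose_LRL_3 [OF z3(1) y3 z3(2)] compose_low [OF z3(1) y3] by (simp add: algebra_simps)
  then have "e * ((c 2 - 1) * c 3) + (c 3 - c 2) * (\<tau> * (1 + q)) = 0"
    using c2' by simp
  then have e: "e * ((c 2 - 1) * c 3) = - ((c 3 - c 2) * (\<tau> * (1 + q)))"
    by linarith
  have "c 3 - \<tau> * (1 + q) = 1 + \<alpha> * (1 + q)"
    by (simp add: c_simps \<tau>_def algebra_simps power2_eq_square)
  moreover have "\<alpha> * (1 + q) > 0" using par q_less by (intro mult_neg_neg) auto
  ultimately have n3: "c 3 - \<tau> * (1 + q) > 0" "c 3 - \<tau> * (1 + q) = 1 + \<alpha> * (1 + q)" by auto
  \<comment> \<open>A vertex at distance 4 from \<open>y3\<close> is available only if b_3 > 0;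
    otherwise the product is 0.\<close>
  have gb: "g * b 3 \<le> 0"
  proof (cases "b 3 = 0")
    case False
    then have "b 3 > 0" using par by simp
    then obtain z4 where z4: "d x z4 = 1" "d z4 y3 = 4"
      using far_neighbour [OF y3] by auto
    have "c 2 * (e * ((c 2 - 1) * c 3) + (c 3 - c 2) * c 3 + g * (c 3 * (c 4 - c 3))) = 0"
      using comp [of z4] z4 unfolding compose_RLL [OF z4(1) y3] compose_LLR [OF z4(1) y3]
        compose_LRL_4 [OF z4(1) y3 z4(2)] compose_low [OF z4(1) y3] by (simp add: algebra_simps)
    then have "e * ((c 2 - 1) * c 3) + (c 3 - c 2) * c 3 + g * (c 3 * (c 4 - c 3)) = 0"
      using c2' by simp
    then have "g * (c 3 * (c 4 - c 3)) = - ((c 3 - c 2) * (c 3 - \<tau> * (1 + q)))"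
      unfolding e by (simp add: algebra_simps)
    also have "\<dots> < 0" using par n3 by simp
    finally have "g * (c 3 * (c 4 - c 3)) < 0" .
    \<comment> \<open>At distance 4 the difference c_4 - c_3 is an entry of \<open>far\<close>,
      hence a count.\<close>
    moreover have "far x 3 z4 y3 \<ge> 0" unfolding far_def low_def by (intro sum_nonneg) auto
    then have "c 3 * (c 4 - c 3) \<ge> 0" using far_3 [OF z4(1) y3] z4 par by simp
    ultimately have "g < 0" by (meson mult_nonneg_nonneg not_le)
    then show ?thesis using par by (simp add: mult_le_0_iff)
  qed simp
  obtain z where z: "d y3 z = 1" "d z x = 2" using geodesic [of y3 x 2] y3 sym by (metis numeral_2_eq_2 numeral_3_eq_3)
  then have z': "d x z = 2" "d z y3 = 1" using sym by auto
  have "e * (c 2)\<^sup>2 + LRL x z y3 + g * (c 2 * b 3) = f"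
    using eq [OF y3, of z] RLL_adjacent [OF z'(1) y3 z'(2)] LLR_adjacent [OF z'(1) y3 z'(2)] y3 z'
    by (simp add: low_def)
  \<comment> \<open>The part of \<open>f\<close> with \<open>g\<close> has the factor c_3 b_3, the
    entry of L^2 R the factor c_2 b_3; their difference has a known sign.\<close>
  then have "LRL x z y3 = e * ((c 2 - 1) * c 3) + e * (k - c 2 - (c 2)\<^sup>2) + c 2 * b 2 + (c 3 - c 2)\<^sup>2
      + (g * b 3) * (c 3 - c 2)"
    unfolding f by (simp add: algebra_simps)
  moreover have "(g * b 3) * (c 3 - c 2) \<le> 0" using gb par by (simp add: mult_nonpos_nonneg)
  ultimately have "b 2 \<le> e * ((c 2 - 1) * c 3) + e * (k - c 2 - (c 2)\<^sup>2) + c 2 * b 2 + (c 3 - c 2)\<^sup>2"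
    using LRL_adjacent [OF z'(1) y3 z'(2)] by linarith
  also have "\<dots> = e * (k - c 2 - (c 2)\<^sup>2) + c 2 * b 2 + (c 3 - c 2) * (c 3 - \<tau> * (1 + q) - c 2)"
    unfolding e by (simp add: algebra_simps power2_eq_square)
  also have "c 3 - \<tau> * (1 + q) - c 2 = - q" unfolding n3(2) by (simp add: c_simps algebra_simps)
  finally have upper: "- e * (k - c 2 - (c 2)\<^sup>2) \<le> (c 2 - 1) * b 2 + (c 3 - c 2) * - q"
    by (simp add: algebra_simps)
  define r where "r = - q"
  define p where "p = c 2 - 1"
  have r: "r > 1" using q_less by (simp add: r_def)
  have p\<alpha>: "p + r = - \<alpha> * (r - 1)" by (simp add: p_def c_simps r_def algebra_simps)
  have "1 \<le> p" using par(2) c2 by (simp add: p_def)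
  moreover have "p \<le> r\<^sup>2 - r - 1"
  proof -
    have "- \<alpha> * (r - 1) \<le> (r + 1) * (r - 1)" using par(7) r by (intro mult_right_mono) (auto simp: r_def)
    then show ?thesis using p\<alpha> by (simp add: algebra_simps power2_eq_square)
  qed
  moreover note r
  moreover have \<Delta>: "c 3 - c 2 = r * (p * (r - 1) + r\<^sup>2)"
  proof -
    have "c 3 - c 2 = r * (r + - \<alpha> * (r - 1) * (r - 1))"
      by (simp add: c_simps r_def algebra_simps power2_eq_square)
    then show ?thesis unfolding p\<alpha> [symmetric] by (simp add: algebra_simps power2_eq_square)
  qed
  moreover have "b 2 \<ge> r\<^sup>2 * (p * (r - 1) + r\<^sup>2 - r + 1)"
  proof -
    have "b 2 - b 3 = r\<^sup>2 * (1 + - \<alpha> * (r - 1) * (r - 1))"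
      by (simp add: b_def r_def algebra_simps power2_eq_square)
    then have "b 2 - b 3 = r\<^sup>2 * (p * (r - 1) + r\<^sup>2 - r + 1)"
      unfolding p\<alpha> [symmetric] by (simp add: algebra_simps power2_eq_square)
    then show ?thesis using par by simp
  qed
  moreover have "- e * (p * (r\<^sup>2 - r + 1)) = r * (r - 1) * (c 3 - c 2)"
  proof -
    \<comment> \<open>The common factor of c_3 and \<tau>, cancelled from the equation for
      \<open>e\<close>.\<close>
    define u where "u = 1 + \<alpha> * (1 + q)"
    have c3: "c 3 = (r\<^sup>2 - r + 1) * u" and \<tau>: "\<tau> = - r * u"
      by (simp_all add: c_simps \<tau>_def u_def r_def algebra_simps)
    have u: "u > 0" using n3 by (simp add: u_def)
    have "u * (- e * (p * (r\<^sup>2 - r + 1))) = u * (r * (r - 1) * (c 3 - c 2))"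
    proof -
      have "e * (p * ((r\<^sup>2 - r + 1) * u)) = - ((c 3 - c 2) * (- r * u * (1 - r)))"
        using e unfolding p_def \<tau> c3 [symmetric] by (simp add: r_def)
      then show ?thesis by (simp add: algebra_simps)
    qed
    then show ?thesis using u by (metis less_irrefl mult_left_cancel)
  qed
  ultimately have lt: "p * b 2 + r * (c 3 - c 2) < - e * (b 2 + (p + r) * (r - 1) - (p + 1)\<^sup>2)"
    by (rule uniform_inequality)
  have "b 2 + (p + r) * (r - 1) - (p + 1)\<^sup>2 = k - c 2 - (c 2)\<^sup>2"
    unfolding p\<alpha> by (simp add: p_def) (simp add: b_def c_simps r_def algebra_simps power2_eq_square)
  then have "p * b 2 + r * (c 3 - c 2) < - e * (k - c 2 - (c 2)\<^sup>2)" using lt by simp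
  moreover have "p * b 2 + r * (c 3 - c 2) = (c 2 - 1) * b 2 + (c 3 - c 2) * - q"
    by (simp add: p_def r_def)
  ultimately show False using upper by linarith
qed

end

section \<open>Graphs with classical parameters\<close>

lemma relpowp_symp:
  assumes "symp r" "(r ^^ n) y z" shows "(r ^^ n) z y"
  using assms(2)
proof (induction n arbitrary: z)
  case (Suc n)
  then obtain w where "(r ^^ n) y w" "r w z" by (meson relpowp_Suc_E)
  then show ?case using Suc.IH [of w] \<open>symp r\<close> relpowp_Suc_I2 [of r z w n y] by (auto dest: sympD)
qed simp

lemma gdist_le: "(adj ^^ n) y z \<Longrightarrow> gdist adj y z \<le> n"
  unfolding gdist_def by (rule Least_le)

locale connected_graph =
  fixes adj :: "'v::finite \<Rightarrow> 'v \<Rightarrow> bool"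
  assumes graph: "connected_simple_graph adj"
begin

lemma sym_adj: "symp adj" and irrefl_adj: "irreflp adj"
  using graph by (auto simp: connected_simple_graph_def)

lemma gdist_walk: "(adj ^^ gdist adj y z) y z"
proof -
  have "adj\<^sup>*\<^sup>* y z" using graph by (simp add: connected_simple_graph_def)
  then obtain n where "(adj ^^ n) y z" by (auto simp: rtranclp_power)
  then show ?thesis unfolding gdist_def by (rule LeastI)
qed

lemma gdist_sym: "gdist adj y z = gdist adj z y"
proof -
  have le: "gdist adj y z \<le> gdist adj z y" for y z
    by (rule gdist_le) (rule relpowp_symp [OF sym_adj gdist_walk])
  show ?thesis by (rule antisym [OF le le])
qed

lemma gdist_0_iff [simp]: "gdist adj y z = 0 \<longleftrightarrow> y = z"
proof
  assume "gdist adj y z = 0"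
  then show "y = z" using gdist_walk [of y z] by simp
next
  assume "y = z"
  then have "(adj ^^ 0) y z" by simp
  then have "gdist adj y z \<le> 0" by (rule gdist_le)
  then show "gdist adj y z = 0" by simp
qed

lemma gdist_self [simp]: "gdist adj y y = 0"
  by simp

lemma gdist_triangle: "gdist adj y z \<le> gdist adj y w + gdist adj w z"
  by (rule gdist_le [OF relpowp_trans [OF gdist_walk gdist_walk]])

lemma gdist_1_iff: "gdist adj y z = 1 \<longleftrightarrow> adj y z"
proof
  assume "gdist adj y z = 1"
  then show "adj y z" using gdist_walk [of y z] by (simp only: relpowp_1)
next
  assume "adj y z"
  then have "(adj ^^ 1) y z" by (simp only: relpowp_1)
  then have "gdist adj y z \<le> 1" by (rule gdist_le)
  moreover have "y \<noteq> z" using \<open>adj y z\<close> irrefl_adj by (auto dest: irreflpD)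
  then have "gdist adj y z \<noteq> 0" by simp
  ultimately show "gdist adj y z = 1" by linarith
qed

lemma gdist_geodesic:
  assumes "gdist adj y z = Suc h"
  shows "\<exists>w. gdist adj y w = 1 \<and> gdist adj w z = h"
proof -
  obtain w where w: "adj y w" "(adj ^^ h) w z"
    using gdist_walk [of y z] unfolding assms by (meson relpowp_Suc_E2)
  then have "gdist adj y w = 1" "gdist adj w z \<le> h" using gdist_1_iff gdist_le by auto
  moreover have "gdist adj y z \<le> gdist adj y w + gdist adj w z" by (rule gdist_triangle)
  ultimately show ?thesis using assms by (intro exI [of _ w]) linarith
qed

lemma gdist_surj: "gdist adj x y = n \<Longrightarrow> j \<le> n \<Longrightarrow> \<exists>z. gdist adj x z = j"
proof (induction n arbitrary: y)
  case (Suc n)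
  obtain w where "gdist adj x w = n"
    using gdist_geodesic [of y x n] Suc.prems gdist_sym by metis
  then show ?case using Suc by (cases "j = Suc n") (auto simp: le_Suc_eq)
qed auto

lemma gdist_le_eccentricity: "gdist adj x y \<le> eccentricity adj x"
  by (simp add: eccentricity_def)

lemma eccentricity_le_diam: "eccentricity adj x \<le> diam adj"
  by (simp add: diam_def)

text \<open>Every edge of a geodesic starting at \<open>x\<close> changes the distance to
  \<open>x\<close>, so it survives flattening.\<close>

lemma gdist_flattened: "gdist (flattened adj x) x y = gdist adj x y"
proof -
  have "(flattened adj x ^^ n) x y" if "gdist adj x y = n" for n
    using that
  proof (induction n arbitrary: y)
    case (Suc n)
    obtain w where w: "gdist adj y w = 1" "gdist adj w x = n"
      using gdist_geodesic [of y x n] Suc.prems gdist_sym by metis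
    then have "flattened adj x w y"
      using Suc.prems gdist_sym [of w x] gdist_sym [of y w] gdist_1_iff [of w y]
      by (simp add: flattened_def)
    then show ?case using Suc.IH [of w] w gdist_sym [of w x] by auto
  qed simp
  moreover have "gdist adj x y \<le> n" if "(flattened adj x ^^ n) x y" for n
  proof (rule gdist_le)
    have "flattened adj x \<le> adj" by (auto simp: flattened_def)
    then show "(adj ^^ n) x y" using that relpowp_mono [of "flattened adj x" adj n x y] by auto
  qed
  ultimately show ?thesis unfolding gdist_def [of "flattened adj x"] by (intro Least_equality) auto
qed

lemma eccentricity_flattened: "eccentricity (flattened adj x) x = eccentricity adj x"
proof -
  have "gdist (flattened adj x) x = gdist adj x" by (rule ext) (rule gdist_flattened)
  then show ?thesis by (simp add: eccentricity_def)
qed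

end

lemma intersection_number_eq:
  assumes "distance_regular adj" "gdist adj y z = h"
  shows "intersection_number adj h i j = dist_count adj i j y z"
  unfolding intersection_number_def
proof (rule the_equality)
  show "\<forall>y' z'. gdist adj y' z' = h \<longrightarrow> dist_count adj i j y' z' = dist_count adj i j y z"
    using assms unfolding distance_regular_def by metis
qed (use assms in blast)

text \<open>The number of vertices at distance \<open>diam adj\<close> from a given vertex is an
  intersection number with h = 0, the same for all vertices and positive for one.\<close>

lemma eccentricity_distance_regular:
  assumes "distance_regular adj" shows "eccentricity adj x = diam adj"
proof -
  interpret connected_graph adj
    using assms by unfold_locales (simp add: distance_regular_def)
  have "diam adj \<in> range (eccentricity adj)" unfolding diam_def by (rule Max_in) auto
  then obtain x0 where "diam adj = eccentricity adj x0" by auto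
  moreover have "eccentricity adj x0 \<in> range (gdist adj x0)" unfolding eccentricity_def by (rule Max_in) auto
  ultimately obtain y0 where y0: "gdist adj x0 y0 = diam adj" by auto
  have "gdist adj x0 x0 = gdist adj x x" by (metis gdist_0_iff)
  then have "dist_count adj (diam adj) (diam adj) x0 x0 = dist_count adj (diam adj) (diam adj) x x"
    using assms unfolding distance_regular_def by blast
  moreover have "dist_count adj (diam adj) (diam adj) x0 x0 > 0"
    unfolding dist_count_def using y0 by (auto simp: card_gt_0_iff)
  ultimately obtain y where "gdist adj x y = diam adj"
    by (auto simp: dist_count_def card_gt_0_iff)
  then have "diam adj \<le> eccentricity adj x" using gdist_le_eccentricity [of x y] by simp
  then show ?thesis using eccentricity_le_diam [of x] by simp
qed

lemma classical_negative_type_metric: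
  fixes adj :: "'v::finite \<Rightarrow> 'v \<Rightarrow> bool"
  assumes cp: "classical_parameters adj D q \<alpha> \<beta>" and D: "D \<ge> 3" and q: "q < - 1"
    and a1: "a_num adj 1 = 0"
  shows "negative_type_metric (gdist adj) q \<alpha> (gauss q D * \<beta>)"
proof -
  have dr: "distance_regular adj" and diam: "diam adj = D"
    and c: "\<And>i. i \<in> {1..D} \<Longrightarrow> real (c_num adj i) = gauss q i * (1 + \<alpha> * gauss q (i - 1))"
    and b: "\<And>i. i < D \<Longrightarrow> real (b_num adj i) = (gauss q D - gauss q i) * (\<beta> - \<alpha> * gauss q i)"
    using cp by (auto simp: classical_parameters_def)
  interpret connected_graph adj
    using dr by unfold_locales (simp add: distance_regular_def)
  have bound: "gdist adj y z \<le> D" for y z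
    using gdist_le_eccentricity [of y z] eccentricity_le_diam [of y] diam by simp
  have ex: "\<exists>z. gdist adj y z = j" if "j \<le> D" for j y
  proof -
    have "eccentricity adj y \<in> range (gdist adj y)" unfolding eccentricity_def by (rule Max_in) auto
    then obtain z where "gdist adj y z = D"
      using eccentricity_distance_regular [OF dr, of y] diam by auto
    then show ?thesis using gdist_surj that by blast
  qed
  have count_b: "real (card {w. gdist adj y w = 1 \<and> gdist adj z w = Suc h})
      = (gauss q D - gauss q h) * (\<beta> - \<alpha> * gauss q h)" if "gdist adj y z = h" "h < D" for y z h
    using b [OF that(2)] intersection_number_eq [OF dr that(1), of 1 "Suc h"]
    by (simp add: b_num_def dist_count_def)
  have triangle_free: "gdist adj z w \<noteq> 1" if "gdist adj y z = 1" "gdist adj y w = 1" for y z w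
    using intersection_number_eq [OF dr that(1), of 1 1] a1 that(2)
    by (auto simp: a_num_def dist_count_def)
  \<comment> \<open>As c_1 = 1 and a_1 = 0, the valency b_0 equals 1 + b_1; both sides are inserted
    in classical form and solved for \<open>\<beta>\<close>.\<close>
  have \<beta>: "\<beta> = 1 + \<alpha> - \<alpha> * gauss q D"
  proof -
    fix y :: 'v
    obtain z where yz: "gdist adj y z = 1" using ex [of 1 y] D by auto
    have zy: "gdist adj z y = 1" using yz gdist_sym by simp
    have "{w. gdist adj y w = 1} = insert z {w. gdist adj y w = 1 \<and> gdist adj z w = Suc 1}"
    proof -
      have "gdist adj z w = 0 \<or> gdist adj z w = Suc 1" if "gdist adj y w = 1" for w
        using triangle_free [OF yz that] gdist_triangle [of z w y] zy that by linarith
      then show ?thesis using yz by auto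
    qed
    moreover have "z \<notin> {w. gdist adj y w = 1 \<and> gdist adj z w = Suc 1}"
      by simp
    ultimately have "real (card {w. gdist adj y w = 1})
        = 1 + real (card {w. gdist adj y w = 1 \<and> gdist adj z w = Suc 1})" by simp
    moreover have "{w. gdist adj y w = 1} = {w. gdist adj y w = 1 \<and> gdist adj y w = Suc 0}" by auto
    moreover have "gdist adj y y = 0" by simp
    ultimately have "gauss q D * \<beta> = 1 + (gauss q D - 1) * (\<beta> - \<alpha>)"
      using count_b [of y y 0] count_b [OF yz] D by simp
    then show ?thesis by (simp add: algebra_simps)
  qed
  show ?thesis
  proof
    show "gdist adj y z = gdist adj z y" for y z by (rule gdist_sym)
    show "gdist adj y z = 0 \<longleftrightarrow> y = z" for y z by simp
    show "gdist adj y z \<le> gdist adj y w + gdist adj w z" for y z w by (rule gdist_triangle)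
    show "\<exists>w. gdist adj y w = 1 \<and> gdist adj w z = h" if "gdist adj y z = Suc h" for y z h
      using gdist_geodesic [OF that] .
    show "card {w. gdist adj y w = i \<and> gdist adj z w = j} = card {w. gdist adj y' w = i \<and> gdist adj z' w = j}"
      if "gdist adj y z = gdist adj y' z'" for y z y' z' i j
      using dr that unfolding distance_regular_def dist_count_def by blast
    show "real (card {w. gdist adj y w = 1 \<and> gdist adj z w = h}) = gauss q (Suc h) * (1 + \<alpha> * gauss q h)"
      if "gdist adj y z = Suc h" for y z h
      using c [of "Suc h"] intersection_number_eq [OF dr that, of 1 h] bound [of y z] that
      by (simp add: c_num_def dist_count_def)
    show "real (card {w. gdist adj y w = 1 \<and> gdist adj z w = Suc h})
        = gauss q D * \<beta> - gauss q h * (1 + \<alpha> - \<alpha> * gauss q h)" if "gdist adj y z = h" for y z h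
    proof (cases "h < D")
      case True
      then show ?thesis using count_b [OF that True] unfolding \<beta> by (simp add: algebra_simps)
    next
      \<comment> \<open>The rewritten formula vanishes at h = D, in agreement with the absence of
        vertices at distance D + 1, so it holds at every occurring distance.\<close>
      case False
      then have "h = D" using bound [of y z] that by simp
      moreover have "{w. gdist adj y w = 1 \<and> gdist adj z w = Suc D} = {}"
      proof -
        have "gdist adj z w \<noteq> Suc D" for w using bound [of z w] by simp
        then show ?thesis by simp
      qed
      ultimately show ?thesis unfolding \<beta> by simp
    qed
    show "gdist adj z w \<noteq> 1" if "gdist adj y z = 1" "gdist adj y w = 1" for y z w
      using triangle_free [OF that] .
    show "q < - 1" by (rule q)
  qed
qed

section \<open>The uniform structure in coordinates\<close>

lemma dual_idem_sandwich:
  "(dual_idem adj x i ** M ** dual_idem adj x j) $ z $ y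
    = (if gdist adj x z = i \<and> gdist adj x y = j then M $ z $ y else 0)"
proof -
  have "(dual_idem adj x i ** M ** dual_idem adj x j) $ z $ y
      = (\<Sum>u\<in>UNIV. (\<Sum>w\<in>UNIV. (if z = w \<and> gdist adj x z = i then 1 else 0) * M $ w $ u)
          * (if u = y \<and> gdist adj x u = j then 1 else 0))"
    by (simp add: matrix_matrix_mult_def dual_idem_def)
  also have "\<dots> = (\<Sum>u\<in>UNIV. if u = y then (if gdist adj x z = i \<and> gdist adj x y = j then M $ z $ y else 0) else 0)"
  proof (rule sum.cong [OF refl])
    fix u
    have "(\<Sum>w\<in>UNIV. (if z = w \<and> gdist adj x z = i then 1 else 0) * M $ w $ u)
        = (\<Sum>w\<in>UNIV. if w = z then (if gdist adj x z = i then M $ z $ u else 0) else 0)"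
      by (intro sum.cong) auto
    then show "(\<Sum>w\<in>UNIV. (if z = w \<and> gdist adj x z = i then 1 else 0) * M $ w $ u)
          * (if u = y \<and> gdist adj x u = j then 1 else 0)
        = (if u = y then (if gdist adj x z = i \<and> gdist adj x y = j then M $ z $ y else 0) else 0)"
      by auto
  qed
  finally show ?thesis by simp
qed

text \<open>For \<open>y\<close> in layer 0 no summand matches, but then the condition on the right
  fails too.\<close>

lemma lowering_nth:
  assumes "gdist adj x y \<le> eccentricity adj x"
  shows "lowering adj x $ z $ y = (if adj z y \<and> gdist adj x y = gdist adj x z + 1 then 1 else 0)"
proof -
  have "lowering adj x $ z $ y = (\<Sum>i = 1..eccentricity adj x.
      if i = gdist adj x y then (if adj z y \<and> gdist adj x y = gdist adj x z + 1 then 1 else 0) else 0)"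
    unfolding lowering_def sum_component dual_idem_sandwich
    by (intro sum.cong) (auto simp: adj_matrix_def)
  then show ?thesis using assms by auto
qed

lemma raising_nth:
  assumes "gdist adj x z \<le> eccentricity adj x" "symp adj"
  shows "raising adj x $ z $ y = (if adj y z \<and> gdist adj x z = gdist adj x y + 1 then 1 else 0)"
proof -
  have "raising adj x $ z $ y = (\<Sum>i = 0..<eccentricity adj x.
      if i = gdist adj x y then (if adj y z \<and> gdist adj x z = gdist adj x y + 1 then 1 else 0) else 0)"
    unfolding raising_def sum_component dual_idem_sandwich
    using \<open>symp adj\<close> by (intro sum.cong) (auto simp: adj_matrix_def dest: sympD)
  then show ?thesis using assms by auto
qed

lemma sum_mult_axis: "(\<Sum>j\<in>UNIV. g j * axis y 1 $ j) = g y" for g :: "'v::finite \<Rightarrow> complex"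
proof -
  have "(\<Sum>j\<in>UNIV. g j * axis y 1 $ j) = (\<Sum>j\<in>UNIV. if j = y then g j else 0)"
    by (intro sum.cong) (auto simp: axis_def)
  then show ?thesis by simp
qed

text \<open>With coordinate vectors as test vectors the condition on E_i^* V is read off entry by
  entry.\<close>

lemma axis_in_range_dual_idem:
  assumes "gdist adj x y = i" shows "axis y 1 \<in> range ((*v) (dual_idem adj x i))"
proof
  show "axis y 1 = dual_idem adj x i *v axis y 1"
    using assms unfolding vec_eq_iff matrix_vector_mult_def
    by (simp add: sum_mult_axis) (auto simp: dual_idem_def axis_def)
qed simp

theorem theorem7p2:
  fixes adj :: "'v::finite \<Rightarrow> 'v \<Rightarrow> bool"
    and x :: 'v
    and D :: nat
    and q \<alpha> \<beta> :: real
  assumes "distance_regular adj"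
    and "\<not> bipartite_graph adj"
    and "diam adj = D"
    and "D \<ge> 3"
    and "classical_parameters adj D q \<alpha> \<beta>"
    and "q < -1"
    and "a_num adj 1 = 0"
  shows "\<not> supports_uniform_structure adj x"
proof
  assume "supports_uniform_structure adj x"
  interpret connected_graph adj
    using assms(1) by unfold_locales (simp add: distance_regular_def)
  interpret negative_type_metric "gdist adj" q \<alpha> "gauss q D * \<beta>"
    using assms by (intro classical_negative_type_metric)
  let ?F = "flattened adj x"
  have ecc: "eccentricity ?F x = D"
    using eccentricity_flattened eccentricity_distance_regular [OF assms(1)] assms(3) by simp
  have le: "gdist ?F x y \<le> eccentricity ?F x" for y
    using gdist_le_eccentricity [of x y] gdist_flattened eccentricity_flattened by simp
  have symF: "symp ?F" using sym_adj by (auto simp: symp_def flattened_def)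
  have L: "lowering ?F x $ z $ y = of_real (low x 1 z y)" for z y
    unfolding lowering_nth [OF le] gdist_flattened flattened_def low_def gdist_1_iff by auto
  have R: "raising ?F x $ z $ y = of_real (low x 1 y z)" for z y
    unfolding raising_nth [OF le symF] gdist_flattened flattened_def low_def gdist_1_iff by auto
  obtain U f where U: "parameter_matrix D U"
    and eq: "\<And>i v. i \<in> {1..D} \<Longrightarrow> v \<in> range ((*v) (dual_idem ?F x i)) \<Longrightarrow>
      e_minus U i *s (raising ?F x *v (lowering ?F x *v (lowering ?F x *v v)))
        + lowering ?F x *v (raising ?F x *v (lowering ?F x *v v))
        + e_plus D U i *s (lowering ?F x *v (lowering ?F x *v (raising ?F x *v v)))
      = f i *s (lowering ?F x *v v)"
    using \<open>supports_uniform_structure adj x\<close>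
    unfolding supports_uniform_structure_def admits_uniform_structure_def Let_def ecc by blast
  have entry: "e_minus U i * of_real (RLL x z y) + of_real (LRL x z y)
      + e_plus D U i * of_real (LLR x z y) = f i * of_real (low x 1 z y)"
    if "gdist adj x y = i" "i \<in> {1..D}" for i y z
  proof -
    have "axis y 1 \<in> range ((*v) (dual_idem ?F x i))"
      using that by (intro axis_in_range_dual_idem) (simp add: gdist_flattened)
    from arg_cong [where f = "\<lambda>v. v $ z", OF eq [OF that(2) this]] show ?thesis
      by (simp add: matrix_vector_mult_def sum_mult_axis L R RLL_def LRL_def LLR_def)
  qed
  obtain y3 where y3: "gdist adj x y3 = 3"
  proof -
    have "eccentricity adj x \<in> range (gdist adj x)" unfolding eccentricity_def by (rule Max_in) auto
    then obtain y where "gdist adj x y = D"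
      using assms(3) eccentricity_distance_regular [OF assms(1), of x] by auto
    then show ?thesis using that gdist_surj [of x y D 3] assms(4) by auto
  qed
  have "e_plus D U 2 = 0" and em: "e_minus U 2 = 1 - of_real (c 2)"
    using uniform_2 [OF y3, of "e_minus U 2" "e_plus D U 2" "f 2"] entry [of _ 2] assms by auto
  \<comment> \<open>As D >= 3, \<open>e_plus\<close> at 2 is a proper entry and not the boundary
    value 0. Its vanishing excludes the alternative of a nonzero superdiagonal, at index 3, and
    leaves the nonzero subdiagonal.\<close>
  then have "U 2 3 = 0" using assms by (simp add: e_plus_def)
  moreover have "(\<forall>i\<in>{2..D}. U i (i - 1) \<noteq> 0) \<or> (\<forall>i\<in>{2..D}. U (i - 1) i \<noteq> 0)"
    using U by (simp add: parameter_matrix_def)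
  moreover have "2 \<in> {2..D}" "3 \<in> {2..D}" using assms(4) by auto
  ultimately have "U 2 (2 - 1) \<noteq> 0" by fastforce
  then have "c 2 \<noteq> 1" using em by (auto simp: e_minus_def)
  \<comment> \<open>The entries of the products are real, so the real parts of the parameters
    satisfy the same equations and can be compared by order.\<close>
  moreover have "Re (e_minus U 3) * RLL x z y + LRL x z y + Re (e_plus D U 3) * LLR x z y
      = Re (f 3) * low x 1 z y" if "gdist adj x y = 3" for z y
    using arg_cong [where f = Re, OF entry [OF that, of z]] assms(4) by simp
  ultimately show False using uniform_3 [OF y3] by blast
qed

end
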